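(* Let $\bm\mu=(\mu_{i,j})$ be a bandit instance with $\mu_{1,1}>\mu_{2,1}$, and set $$H^*(\bm\mu)=\sum_{(i,j)\in\mathcal P}\frac{1}{\max\left[\left(\mu_{i,1}-\frac{\mu_{1,1}+\mu_{2,1}}{2}\right)^2,\,(\mu_{i,j}-\mu_{i,1})^2\right]}.$$ Let $b,c$ be such that $c>2$ and $b>c/2$, let the exploration rate be $$\beta(t,\delta)=\log\frac1\delta+b\log\log\frac1\delta+c\log\log(et),$$ and let $$f_{b,c}(\delta)=\overline K\sqrt e\,\frac{\pi^2}{3}\,\frac1{8^{c/2}}\,\frac{\left(\sqrt{\log(1/\delta)+b\log\log(1/\delta)}+2\sqrt2\right)^c}{(\log(1/\delta))^b}.$$ Then there is a positive constant $C_c$ such that, for $\delta$ small enough, with probability larger than $1-f_{b,c}(\delta)\,\delta$, M-LUCB (with $\epsilon=0$ and this exploration rate) returns the maximin action (i.e. $\hat\imath=1$) and $$\tau_\delta\le 4H^*(\bm\mu)\left[\log\left(\frac1\delta\right)+\log(8C_cH^*(\bm\mu))+2\log\log\left(\frac{8C_cH^*(\bm\mu)}{\delta}\right)\right].$$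
   Context: **Bandit model.** Let $K\ge 2$, $K_1,\dots,K_K\ge 1$ be integers, $\mathcal P=\{(i,j):1\le i\le K,\ 1\le j\le K_i\}$ and $\overline K=\sum_i K_i$. Each arm $P\in\mathcal P$ is a Bernoulli distribution with unknown mean $\mu_P\in[0,1]$; at each round $t=1,2,\dots$ one chooses an arm $P_t$ (depending on past observations) and observes $X_t$ drawn from the Bernoulli distribution with mean $\mu_{P_t}$ (successive draws of an arm are i.i.d., and arms are independent). For the analysis (unknown to the algorithm), actions are labelled so that for each $i$, $j\mapsto\mu_{i,j}$ is nondecreasing, and $i\mapsto\mu_{i,1}$ is nonincreasing; thus the maximin action $i^*\in\operatorname{argmax}_i\min_j\mu_{i,j}$ is $1$. **Confidence bounds.** $N_P(t)=\sum_{s=1}^t\mathbf 1_{(P_s=P)}$, $\hat\mu_P(t)=\frac1{N_P(t)}\sum_{s=1}^tX_s\mathbf 1_{(P_s=P)}$, and $$L_P(t)=\hat\mu_P(t)-\sqrt{\tfrac{\beta(t,\delta)}{2N_P(t)}},\qquad U_P(t)=\hat\mu_P(t)+\sqrt{\tfrac{\beta(t,\delta)}{2N_P(t)}},$$ where $\beta(t,\delta)$ is the exploration rate; when $N_P(t)=0$, $L_P(t)=-\infty$ and $U_P(t)=+\infty$ (and $\hat\mu_P(t)$ is given an arbitrary value). **M-LUCB with $\epsilon=0$.** For every even $t\in\{0,2,4,\dots\}$ let $c_i(t)\in\operatorname{argmin}_{1\le j\le K_i}L_{(i,j)}(t)$, $\hat\imath(t)\in\operatorname{argmax}_i\min_j\hat\mu_{i,j}(t)$,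 and $$H_t=(\hat\imath(t),c_{\hat\imath(t)}(t)),\qquad S_t\in\operatorname{argmax}_{P\in\{(i,c_i(t)):\, i\ne\hat\imath(t)\}}U_P(t)$$ (ties broken arbitrarily). If not yet stopped, the algorithm draws $P_{t+1}=H_t$ and $P_{t+2}=S_t$. It stops at $$\tau_\delta=\inf\Big\{t\in2\mathbb N:\ \min_i\Big[\max_{i'\ne i}\min_{1\le j'\le K_{i'}}U_{(i',j')}(t)-\min_{1\le j\le K_i}L_{(i,j)}(t)\Big]<0\Big\}$$ and recommends $\hat\imath=\hat\imath(\tau_\delta)$. *)

theory Defs
  imports "HOL-Probability.Probability"
begin

section \<open>Maximin games with Bernoulli arms\<close>

text \<open>The arm \<open>(i, j)\<close> is the answer \<open>j\<close> to the action \<open>i\<close>; indices start at 1.\<close>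

type_synonym arm = "nat \<times> nat"

definition arms :: "nat \<Rightarrow> (nat \<Rightarrow> nat) \<Rightarrow> arm set" where
  "arms K Ks = {(i, j). i \<in> {1..K} \<and> j \<in> {1..Ks i}}"

definition bandit_instance :: "nat \<Rightarrow> (nat \<Rightarrow> nat) \<Rightarrow> (arm \<Rightarrow> real) \<Rightarrow> bool" where
  "bandit_instance K Ks \<mu> \<longleftrightarrow>
     2 \<le> K \<and> (\<forall>i\<in>{1..K}. 1 \<le> Ks i) \<and> (\<forall>P\<in>arms K Ks. 0 \<le> \<mu> P \<and> \<mu> P \<le> 1)"

definition ordered_labels :: "nat \<Rightarrow> (nat \<Rightarrow> nat) \<Rightarrow> (arm \<Rightarrow> real) \<Rightarrow> bool" where
  "ordered_labels K Ks \<mu> \<longleftrightarrow>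
     (\<forall>i\<in>{1..K}. mono_on {1..Ks i} (\<lambda>j. \<mu> (i, j))) \<and> antimono_on {1..K} (\<lambda>i. \<mu> (i, 1))"

text \<open>\<open>Y P n\<close> is the outcome of draw number \<open>n\<close> of arm \<open>P\<close>, counted from 0.\<close>

definition bernoulli_draws ::
    "'w measure \<Rightarrow> arm set \<Rightarrow> (arm \<Rightarrow> real) \<Rightarrow> (arm \<Rightarrow> nat \<Rightarrow> 'w \<Rightarrow> bool) \<Rightarrow> bool" where
  "bernoulli_draws M A \<mu> Y \<longleftrightarrow>
     prob_space.indep_vars M (\<lambda>_. count_space UNIV) (\<lambda>(P, n). Y P n) (A \<times> UNIV) \<and>
     (\<forall>P\<in>A. \<forall>n. distr M (count_space UNIV) (Y P n) = measure_pmf (bernoulli_pmf (\<mu> P)))"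


section \<open>Histories and confidence bounds\<close>

text \<open>After \<open>t\<close> rounds the history is the list of the pairs (arm, outcome) of rounds 1 to \<open>t\<close>,
  in chronological order; in particular \<open>t\<close> is its length.\<close>

type_synonym history = "(arm \<times> bool) list"

definition num_draws :: "history \<Rightarrow> arm \<Rightarrow> nat" where
  "num_draws h P = (\<Sum>(Q, x)\<leftarrow>h. of_bool (Q = P))"

text \<open>\<open>m0 P t\<close> is the arbitrary value of the empirical mean at time \<open>t\<close> of an arm \<open>P\<close>
  that has not been drawn.\<close>

definition emp_mean :: "(arm \<Rightarrow> nat \<Rightarrow> real) \<Rightarrow> history \<Rightarrow> arm \<Rightarrow> real" where
  "emp_mean m0 h P =
     (if num_draws h P = 0 then m0 P (length h)
      else (\<Sum>(Q, x)\<leftarrow>h. of_bool x * of_bool (Q = P)) / real (num_draws h P))"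

definition lcb :: "(nat \<Rightarrow> real) \<Rightarrow> (arm \<Rightarrow> nat \<Rightarrow> real) \<Rightarrow> history \<Rightarrow> arm \<Rightarrow> ereal" where
  "lcb \<beta> m0 h P =
     (if num_draws h P = 0 then -\<infinity>
      else ereal (emp_mean m0 h P - sqrt (\<beta> (length h) / (2 * real (num_draws h P)))))"

definition ucb :: "(nat \<Rightarrow> real) \<Rightarrow> (arm \<Rightarrow> nat \<Rightarrow> real) \<Rightarrow> history \<Rightarrow> arm \<Rightarrow> ereal" where
  "ucb \<beta> m0 h P =
     (if num_draws h P = 0 then \<infinity>
      else ereal (emp_mean m0 h P + sqrt (\<beta> (length h) / (2 * real (num_draws h P)))))"


section \<open>M-LUCB\<close>

text \<open>The choice functions \<open>ih\<close>, \<open>cc\<close>, \<open>S\<close> map a history of even length \<open>t\<close> to the recommended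
  action, to the representative answer of each action and to the challenger arm at time \<open>t\<close>.
  Any functions obeying these constraints are allowed, so ties are broken arbitrarily.\<close>

definition mlucb_choices ::
    "nat \<Rightarrow> (nat \<Rightarrow> nat) \<Rightarrow> (nat \<Rightarrow> real) \<Rightarrow> (arm \<Rightarrow> nat \<Rightarrow> real) \<Rightarrow>
     (history \<Rightarrow> nat) \<Rightarrow> (history \<Rightarrow> nat \<Rightarrow> nat) \<Rightarrow> (history \<Rightarrow> arm) \<Rightarrow> bool" where
  "mlucb_choices K Ks \<beta> m0 ih cc S \<longleftrightarrow>
     (\<forall>h. even (length h) \<longrightarrow>
        (\<forall>i\<in>{1..K}. is_arg_min (\<lambda>j. lcb \<beta> m0 h (i, j)) (\<lambda>j. j \<in> {1..Ks i}) (cc h i)) \<and>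
        is_arg_max (\<lambda>i. MIN j\<in>{1..Ks i}. emp_mean m0 h (i, j)) (\<lambda>i. i \<in> {1..K}) (ih h) \<and>
        is_arg_max (ucb \<beta> m0 h) (\<lambda>P. P \<in> (\<lambda>i. (i, cc h i)) ` ({1..K} - {ih h})) (S h))"

text \<open>The arm drawn after history \<open>h\<close>: at even times the first arm \<open>H\<^sub>t\<close> of the pair, and one round
  later the challenger, which was determined by the history of the preceding even time.\<close>

definition mlucb_next ::
    "(history \<Rightarrow> nat) \<Rightarrow> (history \<Rightarrow> nat \<Rightarrow> nat) \<Rightarrow> (history \<Rightarrow> arm) \<Rightarrow> history \<Rightarrow> arm" where
  "mlucb_next ih cc S h = (if even (length h) then (ih h, cc h (ih h)) else S (butlast h))"

text \<open>The history after \<open>t\<close> rounds when arms are selected by \<open>a\<close> and the outcome of draw \<open>n\<close> of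
  arm \<open>P\<close> is \<open>y P n\<close>. The sampling is continued fictitiously after the stopping time; this affects
  neither the stopping time nor the history up to it.\<close>

primrec play :: "(history \<Rightarrow> arm) \<Rightarrow> (arm \<Rightarrow> nat \<Rightarrow> bool) \<Rightarrow> nat \<Rightarrow> history" where
  "play a y 0 = []"
| "play a y (Suc t) =
     (let h = play a y t; P = a h in h @ [(P, y P (num_draws h P))])"

text \<open>Lower bounds are below \<open>\<infinity>\<close> and upper bounds above \<open>-\<infinity>\<close>, so the subtraction in \<^typ>\<open>ereal\<close>
  never meets an undefined case.\<close>

definition mlucb_stops ::
    "nat \<Rightarrow> (nat \<Rightarrow> nat) \<Rightarrow> (nat \<Rightarrow> real) \<Rightarrow> (arm \<Rightarrow> nat \<Rightarrow> real) \<Rightarrow> history \<Rightarrow> bool" where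
  "mlucb_stops K Ks \<beta> m0 h \<longleftrightarrow>
     (MIN i\<in>{1..K}. (MAX i'\<in>{1..K} - {i}. MIN j'\<in>{1..Ks i'}. ucb \<beta> m0 h (i', j'))
                     - (MIN j\<in>{1..Ks i}. lcb \<beta> m0 h (i, j))) < 0"

definition mlucb_time ::
    "nat \<Rightarrow> (nat \<Rightarrow> nat) \<Rightarrow> (nat \<Rightarrow> real) \<Rightarrow> (arm \<Rightarrow> nat \<Rightarrow> real) \<Rightarrow> (nat \<Rightarrow> history) \<Rightarrow> enat" where
  "mlucb_time K Ks \<beta> m0 hist = (INF t\<in>{t. even t \<and> mlucb_stops K Ks \<beta> m0 (hist t)}. enat t)"

text \<open>M-LUCB on a probability space: the choices may depend, besides the history, on a random
  seed \<open>\<xi>\<close> that is independent of all outcomes, so that ties may also be broken at random.\<close>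

definition mlucb_model ::
    "nat \<Rightarrow> (nat \<Rightarrow> nat) \<Rightarrow> (arm \<Rightarrow> real) \<Rightarrow> (nat \<Rightarrow> real) \<Rightarrow> (arm \<Rightarrow> nat \<Rightarrow> real) \<Rightarrow>
     'w measure \<Rightarrow> (arm \<Rightarrow> nat \<Rightarrow> 'w \<Rightarrow> bool) \<Rightarrow> 'r measure \<Rightarrow> ('w \<Rightarrow> 'r) \<Rightarrow>
     ('r \<Rightarrow> history \<Rightarrow> nat) \<Rightarrow> ('r \<Rightarrow> history \<Rightarrow> nat \<Rightarrow> nat) \<Rightarrow> ('r \<Rightarrow> history \<Rightarrow> arm) \<Rightarrow> bool" where
  "mlucb_model K Ks \<mu> \<beta> m0 M Y R \<xi> ih cc S \<longleftrightarrow>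
     prob_space M \<and>
     bernoulli_draws M (arms K Ks) \<mu> Y \<and>
     \<xi> \<in> measurable M R \<and>
     prob_space.indep_set M
       {\<xi> -` A \<inter> space M | A. A \<in> sets R}
       {(\<lambda>\<omega>. restrict (\<lambda>(P, n). Y P n \<omega>) (arms K Ks \<times> UNIV)) -` B \<inter> space M | B.
          B \<in> sets (Pi\<^sub>M (arms K Ks \<times> UNIV) (\<lambda>_. count_space UNIV))} \<and>
     (\<forall>h. (\<lambda>r. ih r h) \<in> measurable R (count_space UNIV)) \<and>
     (\<forall>h i. (\<lambda>r. cc r h i) \<in> measurable R (count_space UNIV)) \<and>
     (\<forall>h. (\<lambda>r. S r h) \<in> measurable R (count_space UNIV)) \<and>
     (\<forall>r\<in>space R. mlucb_choices K Ks \<beta> m0 (ih r) (cc r) (S r))"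

definition mlucb_history ::
    "(arm \<Rightarrow> nat \<Rightarrow> 'w \<Rightarrow> bool) \<Rightarrow> ('w \<Rightarrow> 'r) \<Rightarrow>
     ('r \<Rightarrow> history \<Rightarrow> nat) \<Rightarrow> ('r \<Rightarrow> history \<Rightarrow> nat \<Rightarrow> nat) \<Rightarrow> ('r \<Rightarrow> history \<Rightarrow> arm) \<Rightarrow>
     'w \<Rightarrow> nat \<Rightarrow> history" where
  "mlucb_history Y \<xi> ih cc S \<omega> =
     play (mlucb_next (ih (\<xi> \<omega>)) (cc (\<xi> \<omega>)) (S (\<xi> \<omega>))) (\<lambda>P n. Y P n \<omega>)"


section \<open>Quantities in the bound\<close>

definition H_star :: "nat \<Rightarrow> (nat \<Rightarrow> nat) \<Rightarrow> (arm \<Rightarrow> real) \<Rightarrow> real" where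
  "H_star K Ks \<mu> =
     (\<Sum>(i, j)\<in>arms K Ks.
        1 / max ((\<mu> (i, 1) - (\<mu> (1, 1) + \<mu> (2, 1)) / 2)\<^sup>2) ((\<mu> (i, j) - \<mu> (i, 1))\<^sup>2))"

text \<open>The value at \<open>t = 0\<close> is irrelevant: at that time all confidence bounds are infinite.\<close>

definition explor_rate :: "real \<Rightarrow> real \<Rightarrow> real \<Rightarrow> nat \<Rightarrow> real" where
  "explor_rate b c \<delta> t = ln (1 / \<delta>) + b * ln (ln (1 / \<delta>)) + c * ln (ln (exp 1 * real t))"

definition f_bc :: "nat \<Rightarrow> (nat \<Rightarrow> nat) \<Rightarrow> real \<Rightarrow> real \<Rightarrow> real \<Rightarrow> real" where
  "f_bc K Ks b c \<delta> =
     real (\<Sum>i=1..K. Ks i) * sqrt (exp 1) * (pi\<^sup>2 / 3) * (1 / 8 powr (c / 2)) *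
     ((sqrt (ln (1 / \<delta>) + b * ln (ln (1 / \<delta>))) + 2 * sqrt 2) powr c / (ln (1 / \<delta>)) powr b)"

definition time_bound :: "real \<Rightarrow> real \<Rightarrow> real \<Rightarrow> real" where
  "time_bound C H \<delta> =
     4 * H * (ln (1 / \<delta>) + ln (8 * C * H) + 2 * ln (ln (8 * C * H / \<delta>)))"

end

theory Submission
  imports Defs "HOL-Real_Asymp.Real_Asymp"
begin

text \<open>
  Peeling over geometric slices with Ville's inequality makes all confidence intervals valid at
  all times, up to a probability that has the value of the zeta function at \<open>c - o(1) > 2\<close> where
  \<open>f_bc\<close> has \<open>\<pi>\<^sup>2 / 6\<close>. While the algorithm runs, one of the two arms of each round has a
  confidence interval that contains the midpoint of the two best action values, which bounds its
  number of draws by \<open>2 \<beta> / \<Delta>\<^sup>2\<close>.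

  Summing these bounds is not enough: it gives \<open>\<tau> \<le> 4 H \<beta>(\<tau>)\<close>, which exceeds the time bound
  when \<open>b > 2\<close>. For the arms \<open>(1, 1)\<close> and \<open>(2, 1)\<close>, however, the factor 2 is reached only if
  the empirical mean deviates by almost a full confidence radius. Both deviate by three quarters
  of a radius only with probability about \<open>\<delta> powr (9 / 8)\<close>, which the gap between the two zeta
  values absorbs. So one of them needs a factor at most \<open>49 / 32\<close>, and as its gap is at most
  \<open>1 / 2\<close>, this saves a multiple of \<open>log (1 / \<delta>)\<close>, more than all lower order terms.
  Hence \<open>\<tau> \<le> 4 H log (1 / \<delta>)\<close>, and the constant \<open>C = 1\<close> works.
\<close>


section \<open>Time-uniform deviations of sub-Gaussian sums\<close>

text \<open>Freezing the product once it reaches \<open>a\<close> turns a crossing at some time up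
  to \<open>N\<close> into a property of the value at time \<open>N\<close>, to which Markov's
  inequality applies.\<close>

primrec stopped_prod :: "real \<Rightarrow> (nat \<Rightarrow> real) \<Rightarrow> nat \<Rightarrow> real" where
  "stopped_prod a z 0 = 1"
| "stopped_prod a z (Suc n) =
     stopped_prod a z n * (if a \<le> stopped_prod a z n then 1 else z n)"

lemma stopped_prod_cong:
  "(\<And>i. i < n \<Longrightarrow> z i = z' i) \<Longrightarrow> stopped_prod a z n = stopped_prod a z' n"
  by (induction n) auto

lemma stopped_prod_nonneg: "(\<And>i. 0 \<le> z i) \<Longrightarrow> 0 \<le> stopped_prod a z n"
  by (induction n) auto

lemma stopped_prod_ge:
  assumes "a \<le> (\<Prod>i<n. z i)" "n \<le> N"
  shows "a \<le> stopped_prod a z N"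
proof -
  have "a \<le> stopped_prod a z n \<or> stopped_prod a z n = (\<Prod>i<n. z i)" for n
    by (induction n) auto
  with assms(1) have "a \<le> stopped_prod a z n"
    by metis
  with assms(2) show ?thesis
    by (induction rule: dec_induct) auto
qed

section \<open>Ville's inequality and boundary crossing of sub-Gaussian sums\<close>

context prob_space
begin

lemma indep_var_nn_integral:
  fixes X Y :: "'a \<Rightarrow> real"
  assumes indep: "indep_var borel X borel Y"
    and nonneg: "\<And>\<omega>. 0 \<le> X \<omega>" "\<And>\<omega>. 0 \<le> Y \<omega>"
  shows "(\<integral>\<^sup>+\<omega>. ennreal (X \<omega> * Y \<omega>) \<partial>M) = (\<integral>\<^sup>+\<omega>. X \<omega> \<partial>M) * (\<integral>\<^sup>+\<omega>. Y \<omega> \<partial>M)"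
proof -
  have "indep_vars (\<lambda>_. borel) (\<lambda>b. ennreal \<circ> (case_bool X Y b)) UNIV"
    using indep unfolding indep_var_def
    by (intro indep_vars_compose[where M' = "case_bool borel borel"])
       (auto split: bool.split)
  from indep_vars_nn_integral[OF _ this] nonneg show ?thesis
    by (simp add: UNIV_bool ennreal_mult ac_simps)
qed

lemma ville_inequality:
  assumes indep: "indep_vars (\<lambda>_. borel) Z (UNIV :: nat set)"
    and nonneg: "\<And>i \<omega>. 0 \<le> Z i \<omega>"
    and mean: "\<And>i. (\<integral>\<^sup>+\<omega>. ennreal (Z i \<omega>) \<partial>M) \<le> 1"
    and "0 < a"
  shows "prob {\<omega> \<in> space M. \<exists>n\<le>N. a \<le> (\<Prod>i<n. Z i \<omega>)} \<le> 1 / a"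
proof -
  define W where "W n \<omega> = stopped_prod a (\<lambda>i. Z i \<omega>) n" for n \<omega>
  have [measurable]: "Z i \<in> borel_measurable M" for i
    using indep by (auto simp: indep_vars_def)
  have W_meas [measurable]: "W n \<in> borel_measurable M" for n
    unfolding W_def by (induction n) simp_all
  have W_nonneg: "0 \<le> W n \<omega>" for n \<omega>
    unfolding W_def using nonneg by (rule stopped_prod_nonneg)
  have W_mean: "(\<integral>\<^sup>+\<omega>. ennreal (W n \<omega>) \<partial>M) \<le> 1" for n
  proof (induction n)
    case 0
    then show ?case by (simp add: W_def emeasure_space_1)
  next
    case (Suc n)
    define B where "B \<omega> = (if a \<le> W n \<omega> then 0 else W n \<omega>)" for \<omega>
    define A where "A \<omega> = (if a \<le> W n \<omega> then W n \<omega> else 0)" for \<omega>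
    have [measurable]: "A \<in> borel_measurable M" "B \<in> borel_measurable M"
      unfolding A_def B_def by measurable
    have AB: "0 \<le> A \<omega>" "0 \<le> B \<omega>" for \<omega>
      using W_nonneg by (auto simp: A_def B_def)
    \<comment> \<open>Writing \<open>B\<close> as a function of the first \<open>n\<close> factors
      lets the independence of disjoint index blocks yield that of \<open>B\<close> and
      \<open>Z n\<close>.\<close>
    define g where
      "g f = (if a \<le> stopped_prod a f n then 0 else stopped_prod a f n)" for f
    have sp [measurable]: "(\<lambda>f. stopped_prod a f k) \<in> borel_measurable (Pi\<^sub>M {..<n} (\<lambda>_. borel))"
      if "k \<le> n" for k
      using that
    proof (induction k)
      case (Suc k)
      then have [measurable]: "(\<lambda>f. stopped_prod a f k) \<in> borel_measurable (Pi\<^sub>M {..<n} (\<lambda>_. borel))"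
        "(\<lambda>f. f k) \<in> borel_measurable (Pi\<^sub>M {..<n} (\<lambda>_. borel :: real measure))"
        by (auto intro!: measurable_component_singleton)
      show ?case by simp
    qed simp
    have [measurable]: "g \<in> borel_measurable (Pi\<^sub>M {..<n} (\<lambda>_. borel))"
      unfolding g_def using sp[OF order_refl] by measurable
    have "indep_var (Pi\<^sub>M {..<n} (\<lambda>_. borel)) (\<lambda>\<omega>. restrict (\<lambda>i. Z i \<omega>) {..<n})
        (Pi\<^sub>M {n} (\<lambda>_. borel)) (\<lambda>\<omega>. restrict (\<lambda>i. Z i \<omega>) {n})"
      by (rule indep_var_restrict[OF indep]) auto
    then have "indep_var borel (g \<circ> (\<lambda>\<omega>. restrict (\<lambda>i. Z i \<omega>) {..<n}))
        borel ((\<lambda>f. f n) \<circ> (\<lambda>\<omega>. restrict (\<lambda>i. Z i \<omega>) {n}))"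
      by (rule indep_var_compose) (auto intro!: measurable_component_singleton)
    moreover have "stopped_prod a (restrict (\<lambda>i. Z i \<omega>) {..<n}) n = W n \<omega>" for \<omega>
      unfolding W_def by (rule stopped_prod_cong) simp
    then have "g \<circ> (\<lambda>\<omega>. restrict (\<lambda>i. Z i \<omega>) {..<n}) = B"
      by (simp add: fun_eq_iff g_def B_def)
    moreover have "(\<lambda>f. f n) \<circ> (\<lambda>\<omega>. restrict (\<lambda>i. Z i \<omega>) {n}) = Z n"
      by (simp add: fun_eq_iff)
    ultimately have "indep_var borel B borel (Z n)"
      by simp
    then have BZ: "(\<integral>\<^sup>+\<omega>. ennreal (B \<omega> * Z n \<omega>) \<partial>M) = (\<integral>\<^sup>+\<omega>. B \<omega> \<partial>M) * (\<integral>\<^sup>+\<omega>. Z n \<omega> \<partial>M)"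
      by (rule indep_var_nn_integral) (use AB nonneg in auto)
    have "(\<integral>\<^sup>+\<omega>. ennreal (W (Suc n) \<omega>) \<partial>M) = (\<integral>\<^sup>+\<omega>. ennreal (A \<omega>) + ennreal (B \<omega> * Z n \<omega>) \<partial>M)"
      by (intro nn_integral_cong) (auto simp: W_def A_def B_def)
    also have "\<dots> = (\<integral>\<^sup>+\<omega>. A \<omega> \<partial>M) + (\<integral>\<^sup>+\<omega>. B \<omega> \<partial>M) * (\<integral>\<^sup>+\<omega>. Z n \<omega> \<partial>M)"
      by (subst nn_integral_add) (auto simp: BZ)
    also have "\<dots> \<le> (\<integral>\<^sup>+\<omega>. A \<omega> \<partial>M) + (\<integral>\<^sup>+\<omega>. B \<omega> \<partial>M) * 1"
      by (intro add_mono mult_left_mono mean) auto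
    also have "\<dots> = (\<integral>\<^sup>+\<omega>. ennreal (A \<omega>) + ennreal (B \<omega>) \<partial>M)"
      by (subst nn_integral_add) auto
    also have "\<dots> = (\<integral>\<^sup>+\<omega>. ennreal (W n \<omega>) \<partial>M)"
      by (intro nn_integral_cong) (auto simp: A_def B_def)
    finally show ?case using Suc by simp
  qed
  have "{\<omega> \<in> space M. \<exists>n\<le>N. a \<le> (\<Prod>i<n. Z i \<omega>)} \<subseteq>
      {\<omega> \<in> space M. 1 \<le> ennreal (1 / a) * ennreal (W N \<omega>)}"
  proof safe
    fix \<omega> n
    assume "n \<le> N" "a \<le> (\<Prod>i<n. Z i \<omega>)"
    then have "a \<le> W N \<omega>"
      unfolding W_def by (rule stopped_prod_ge[rotated])
    then have "1 \<le> 1 / a * W N \<omega>"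
      using \<open>0 < a\<close> by (simp add: field_simps)
    then show "1 \<le> ennreal (1 / a) * ennreal (W N \<omega>)"
      using \<open>0 < a\<close> W_nonneg by (simp flip: ennreal_mult ennreal_1)
  qed
  then have "emeasure M {\<omega> \<in> space M. \<exists>n\<le>N. a \<le> (\<Prod>i<n. Z i \<omega>)} \<le>
      emeasure M {\<omega> \<in> space M. 1 \<le> ennreal (1 / a) * ennreal (W N \<omega>)}"
    by (intro emeasure_mono) auto
  also have "\<dots> \<le> ennreal (1 / a) * (\<integral>\<^sup>+\<omega>. ennreal (W N \<omega>) * indicator (space M) \<omega> \<partial>M)"
    using nn_integral_Markov_inequality[of "\<lambda>\<omega>. ennreal (W N \<omega>)" "space M" M "ennreal (1 / a)"]
    by simp
  also have "(\<integral>\<^sup>+\<omega>. ennreal (W N \<omega>) * indicator (space M) \<omega> \<partial>M) = (\<integral>\<^sup>+\<omega>. ennreal (W N \<omega>) \<partial>M)"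
    by (intro nn_integral_cong) auto
  also have "ennreal (1 / a) * \<dots> \<le> ennreal (1 / a) * 1"
    by (intro mult_left_mono W_mean) auto
  finally show ?thesis
    using \<open>0 < a\<close> by (simp add: emeasure_eq_measure)
qed

text \<open>Ville's inequality for the factors \<open>exp (l * X i - l\<^sup>2 / 8)\<close>, whose
  means are at most 1 by Hoeffding's lemma on an interval of length 1. Their product reaches
  \<open>exp z\<close> exactly when the sum reaches the line.\<close>

lemma subgaussian_line_crossing:
  fixes X :: "nat \<Rightarrow> 'a \<Rightarrow> real"
  assumes indep: "indep_vars (\<lambda>_. borel) X UNIV"
    and bounded: "\<And>i. AE \<omega> in M. X i \<omega> \<in> {a i..a i + 1}"
    and mean: "\<And>i. expectation (X i) = 0"
    and "0 < l"
  shows "prob {\<omega> \<in> space M. \<exists>n\<le>N. z / l + l * real n / 8 \<le> (\<Sum>i<n. X i \<omega>)} \<le> exp (- z)"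
proof -
  define Z where "Z i \<omega> = exp (l * X i \<omega> - l\<^sup>2 / 8)" for i \<omega>
  have [measurable]: "X i \<in> borel_measurable M" for i
    using indep by (auto simp: indep_vars_def)
  have Z_nonneg: "0 \<le> Z i \<omega>" for i \<omega>
    by (simp add: Z_def)
  have "indep_vars (\<lambda>_. borel) Z UNIV"
    unfolding Z_def by (rule indep_vars_compose2[OF indep]) measurable
  moreover have "(\<integral>\<^sup>+\<omega>. ennreal (Z i \<omega>) \<partial>M) \<le> 1" for i
  proof -
    interpret X: interval_bounded_random_variable M "X i" "a i" "a i + 1"
      by unfold_locales (use bounded in auto)
    have "(\<integral>\<^sup>+\<omega>. ennreal (Z i \<omega>) \<partial>M) =
        (\<integral>\<^sup>+\<omega>. ennreal (exp (- (l\<^sup>2 / 8))) * ennreal (exp (l * X i \<omega>)) \<partial>M)"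
      by (intro nn_integral_cong) (simp add: Z_def flip: ennreal_mult exp_add)
    also have "\<dots> = ennreal (exp (- (l\<^sup>2 / 8))) * (\<integral>\<^sup>+\<omega>. ennreal (exp (l * X i \<omega>)) \<partial>M)"
      by (rule nn_integral_cmult) measurable
    also have "\<dots> \<le> ennreal (exp (- (l\<^sup>2 / 8))) * ennreal (exp (l\<^sup>2 * (a i + 1 - a i)\<^sup>2 / 8))"
      by (intro mult_left_mono X.Hoeffdings_lemma_nn_integral_0 \<open>0 < l\<close> mean) auto
    also have "\<dots> = 1"
      by (simp flip: ennreal_mult exp_add)
    finally show ?thesis .
  qed
  ultimately have "prob {\<omega> \<in> space M. \<exists>n\<le>N. exp z \<le> (\<Prod>i<n. Z i \<omega>)} \<le> 1 / exp z"
    by (intro ville_inequality) (simp_all add: Z_nonneg)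
  moreover have "(exp z \<le> (\<Prod>i<n. Z i \<omega>)) \<longleftrightarrow> z / l + l * real n / 8 \<le> (\<Sum>i<n. X i \<omega>)" for n \<omega>
  proof -
    have "(\<Prod>i<n. Z i \<omega>) = exp (l * (\<Sum>i<n. X i \<omega>) - l\<^sup>2 / 8 * real n)"
      unfolding Z_def by (subst exp_sum[symmetric]) (simp_all add: sum_subtractf sum_distrib_left)
    then show ?thesis
      using \<open>0 < l\<close> by (simp add: field_simps power2_eq_square)
  qed
  ultimately show ?thesis
    by (simp add: exp_minus inverse_eq_divide)
qed

text \<open>On \<open>[p\<^sup>2, q\<^sup>2]\<close> the concave boundary \<open>sqrt (y n / 2)\<close> lies above its chord.\<close>

lemma subgaussian_slice:
  fixes X :: "nat \<Rightarrow> 'a \<Rightarrow> real"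
  assumes indep: "indep_vars (\<lambda>_. borel) X UNIV"
    and bounded: "\<And>i. AE \<omega> in M. X i \<omega> \<in> {a i..a i + 1}"
    and mean: "\<And>i. expectation (X i) = 0"
    and pq: "0 < p" "0 < q" and "0 < y"
  shows "prob {\<omega> \<in> space M. \<exists>n\<le>N. p\<^sup>2 \<le> real n \<and> real n \<le> q\<^sup>2 \<and>
      sqrt (real n * y / 2) \<le> (\<Sum>i<n. X i \<omega>)} \<le> exp (- (4 * y * p * q / (p + q)\<^sup>2))"
proof -
  \<comment> \<open>Slope \<open>l / 8\<close> and intercept \<open>z / l\<close> are those of the
    chord of the boundary between \<open>n = p\<^sup>2\<close> and
    \<open>n = q\<^sup>2\<close>.\<close>
  define l where "l = 8 * sqrt (y / 2) / (p + q)"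
  define z where "z = 4 * y * p * q / (p + q)\<^sup>2"
  have "0 < l"
    using pq \<open>0 < y\<close> by (simp add: l_def)
  have [measurable]: "X i \<in> borel_measurable M" for i
    using indep by (auto simp: indep_vars_def)
  have chord: "z / l + l * real n / 8 \<le> sqrt (real n * y / 2)"
    if "p\<^sup>2 \<le> real n" "real n \<le> q\<^sup>2" for n
  proof -
    define u where "u = sqrt (real n)"
    have u: "p \<le> u" "u \<le> q" "u\<^sup>2 = real n"
      using that pq by (auto simp: u_def real_le_rsqrt real_le_lsqrt)
    \<comment> \<open>In terms of \<open>u = sqrt n\<close>, the chord lies below the boundary iff
      \<open>p * q + u\<^sup>2 \<le> (p + q) * u\<close>, which is this product expanded.\<close>
    have "0 \<le> (u - p) * (q - u)"
      using u by simp
    then have "(p * q + u\<^sup>2) / (p + q) \<le> u"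
      using pq by (simp add: field_simps power2_eq_square)
    then have "sqrt (y / 2) * ((p * q + u\<^sup>2) / (p + q)) \<le> sqrt (y / 2) * u"
      using \<open>0 < y\<close> by (intro mult_left_mono) auto
    also have "\<dots> = sqrt (real n * y / 2)"
      by (simp add: u_def real_sqrt_mult real_sqrt_divide)
    also have "sqrt (y / 2) * ((p * q + u\<^sup>2) / (p + q)) = z / l + l * real n / 8"
    proof -
      define r where "r = sqrt (y / 2)"
      have r: "y = 2 * r\<^sup>2" "0 < r"
        using \<open>0 < y\<close> by (simp_all add: r_def)
      define d where "d = p + q"
      have "z = 8 * r\<^sup>2 * p * q / d\<^sup>2"
        by (simp add: z_def r(1) d_def)
      moreover have "l = 8 * r / d"
        by (simp add: l_def r_def d_def)
      moreover have "0 < d"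
        using pq by (simp add: d_def)
      ultimately have "z / l = r * p * q / d" "l * real n / 8 = r * u\<^sup>2 / d"
        using \<open>0 < r\<close> u(3) by (simp_all add: power2_eq_square)
      then have eqs: "z / l = r * p * q / (p + q)" "l * real n / 8 = r * u\<^sup>2 / (p + q)"
        by (simp_all only: d_def)
      show ?thesis
        unfolding eqs r_def[symmetric] by (simp add: add_divide_distrib distrib_left mult_ac)
    qed
    finally show ?thesis .
  qed
  have "prob {\<omega> \<in> space M. \<exists>n\<le>N. p\<^sup>2 \<le> real n \<and> real n \<le> q\<^sup>2 \<and>
      sqrt (real n * y / 2) \<le> (\<Sum>i<n. X i \<omega>)} \<le>
      prob {\<omega> \<in> space M. \<exists>n\<le>N. z / l + l * real n / 8 \<le> (\<Sum>i<n. X i \<omega>)}"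
    by (intro finite_measure_mono) (use chord in \<open>fastforce+\<close>)
  also have "\<dots> \<le> exp (- z)"
    by (rule subgaussian_line_crossing[OF indep bounded mean \<open>0 < l\<close>])
  finally show ?thesis
    by (simp add: z_def)
qed

text \<open>Peeling over the slices \<open>[\<rho>^(k-1), \<rho>^k]\<close> with ratio \<open>\<rho> = 1 + sqrt (8 / x)\<close>; the bound \<open>s\<close>
  stands for the value of the zeta function at \<open>c (1 - 1 / (2 x))\<close>.\<close>

lemma subgaussian_uniform_deviation:
  fixes X :: "nat \<Rightarrow> 'a \<Rightarrow> real"
  assumes indep: "indep_vars (\<lambda>_. borel) X UNIV"
    and bounded: "\<And>i. AE \<omega> in M. X i \<omega> \<in> {a i..a i + 1}"
    and mean: "\<And>i. expectation (X i) = 0"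
    and x: "8 \<le> x" and c: "0 \<le> c"
    and s: "\<And>J :: nat set. finite J \<Longrightarrow> 0 \<notin> J \<Longrightarrow>
      (\<Sum>k\<in>J. real k powr - (c * (1 - 1 / (2 * x)))) \<le> s"
  shows "prob {\<omega> \<in> space M. \<exists>n\<in>{1..N}.
        sqrt (real n * (x + c * ln (ln (exp 1 * real n))) / 2) \<le> (\<Sum>i<n. X i \<omega>)}
      \<le> sqrt (exp 1) * s * (sqrt x / (2 * sqrt 2) + 1) powr c * exp (- x)"
    (is "prob ?B \<le> _")
proof -
  define \<eta> where "\<eta> = sqrt (8 / x)"
  define \<rho> where "\<rho> = 1 + \<eta>"
  define g where "g = 1 - 1 / (2 * x)"
  \<comment> \<open>The rate at the left end \<open>\<rho> ^ (k - 1)\<close> of slice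
    \<open>k\<close>. The rate is nondecreasing in \<open>n\<close>, so using this value on the
    whole slice only enlarges the event.\<close>
  define y where "y k = x + c * ln (1 + real (k - 1) * ln \<rho>)" for k :: nat
  define A where "A k = {\<omega> \<in> space M. \<exists>n\<le>N.
      (sqrt (\<rho> ^ (k - 1)))\<^sup>2 \<le> real n \<and> real n \<le> (sqrt (\<rho> ^ k))\<^sup>2 \<and>
      sqrt (real n * y k / 2) \<le> (\<Sum>i<n. X i \<omega>)}" for k :: nat
  \<comment> \<open>Only finitely many slices meet \<open>{1..N}\<close>. The \<open>Suc\<close>
    keeps 0 out of \<open>J\<close>, as the hypothesis on \<open>s\<close> requires.\<close>
  define J where "J = (\<lambda>n. Suc (nat \<lfloor>log \<rho> (real n)\<rfloor>)) ` {1..N}"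
  have [measurable]: "X i \<in> borel_measurable M" for i
    using indep by (auto simp: indep_vars_def)
  have \<eta>: "0 < \<eta>" "\<eta> \<le> 1" "\<eta>\<^sup>2 = 8 / x"
    using x by (auto simp: \<eta>_def)
  have \<rho>: "1 < \<rho>"
    using \<eta> by (simp add: \<rho>_def)
  \<comment> \<open>The last bound becomes the factor
    \<open>(sqrt x / (2 * sqrt 2) + 1) powr c\<close>; the second one allows passing from
    \<open>1 + (k - 1) * ln \<rho>\<close> to \<open>k * ln \<rho>\<close>.\<close>
  have ln_\<rho>: "0 < ln \<rho>" "ln \<rho> \<le> 1" "1 / ln \<rho> \<le> sqrt x / (2 * sqrt 2) + 1"
  proof -
    show "0 < ln \<rho>"
      using \<rho> by simp
    show "ln \<rho> \<le> 1"
      using ln_add_one_self_le_self[of \<eta>] \<eta> by (simp add: \<rho>_def)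
    have "- ln \<rho> = ln (1 / \<rho>)"
      using \<rho> by (simp add: ln_div)
    also have "\<dots> \<le> 1 / \<rho> - 1"
      using \<rho> by (intro ln_le_minus_one) auto
    also have "\<dots> = - (\<eta> / (1 + \<eta>))"
      using \<eta> by (simp add: \<rho>_def field_simps)
    finally have "\<eta> / (1 + \<eta>) \<le> ln \<rho>"
      by simp
    then have "1 / ln \<rho> \<le> 1 / (\<eta> / (1 + \<eta>))"
      using \<eta> \<open>0 < ln \<rho>\<close> by (intro divide_left_mono mult_pos_pos) auto
    also have "\<dots> = 1 / \<eta> + 1"
      using \<eta> by (simp add: field_simps)
    also have "1 / \<eta> = sqrt x / sqrt 8"
      by (simp add: \<eta>_def real_sqrt_divide)
    also have "sqrt 8 = 2 * sqrt 2"
      using real_sqrt_mult[of 4 2] by simp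
    finally show "1 / ln \<rho> \<le> sqrt x / (2 * sqrt 2) + 1" .
  qed
  \<comment> \<open>The loss of \<open>1 / 2\<close> in \<open>g * x\<close> is the source of the
    factor \<open>sqrt (exp 1)\<close>.\<close>
  have g: "0 \<le> g" "g \<le> 1" "g * x = x - 1 / 2"
    using x by (auto simp: g_def field_simps)
  have A_meas: "A k \<in> sets M" for k
    unfolding A_def by measurable
  have A_le: "prob (A k) \<le> sqrt (exp 1) * (sqrt x / (2 * sqrt 2) + 1) powr c * exp (- x) *
      real k powr - (c * g)" if "1 \<le> k" for k
  proof -
    have ge1: "1 \<le> 1 + real (k - 1) * ln \<rho>"
      using ln_\<rho> by simp
    then have "0 \<le> ln (1 + real (k - 1) * ln \<rho>)"
      by simp
    then have "0 < y k"
      using x c unfolding y_def by (intro add_pos_nonneg mult_nonneg_nonneg) auto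
    define r where "r = sqrt (\<rho> ^ (k - 1))"
    have "0 < r"
      using \<rho> by (simp add: r_def)
    have k: "sqrt (\<rho> ^ k) = r * sqrt \<rho>"
      using \<open>1 \<le> k\<close> by (cases k) (simp_all add: r_def real_sqrt_mult)
    have "4 * y k * r * sqrt (\<rho> ^ k) / (r + sqrt (\<rho> ^ k))\<^sup>2 = y k * (4 * sqrt \<rho> / (1 + sqrt \<rho>)\<^sup>2)"
    proof -
      have "r + r * sqrt \<rho> = r * (1 + sqrt \<rho>)"
        by (simp add: algebra_simps)
      then show ?thesis
        using \<open>0 < r\<close> by (simp add: k power_mult_distrib power2_eq_square)
    qed
    \<comment> \<open>With \<open>v = sqrt \<rho>\<close> the right side is
      \<open>1 - ((v - 1) / (v + 1))\<^sup>2\<close>. As \<open>v - 1 = \<eta> / (v + 1)\<close> and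
      \<open>v + 1 \<ge> 2\<close>, the subtracted term is at most
      \<open>\<eta>\<^sup>2 / 16 = 1 / (2 * x)\<close>.\<close>
    moreover have "g \<le> 4 * sqrt \<rho> / (1 + sqrt \<rho>)\<^sup>2"
    proof -
      define v where "v = sqrt \<rho>"
      have v: "1 \<le> v" "v\<^sup>2 = 1 + \<eta>"
        using \<rho> by (auto simp: v_def \<rho>_def)
      have "\<eta>\<^sup>2 = (v - 1)\<^sup>2 * (1 + v)\<^sup>2"
      proof -
        have "\<eta> = (v - 1) * (1 + v)"
          using v(2) by (simp add: power2_eq_square algebra_simps)
        then show ?thesis
          by (simp add: power_mult_distrib)
      qed
      moreover have "2 \<^sup>2 \<le> (1 + v)\<^sup>2"
        using v by (intro power_mono) auto
      ultimately have "(v - 1)\<^sup>2 * 4 \<le> \<eta>\<^sup>2"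
        by (simp add: mult_left_mono)
      then have "(v - 1)\<^sup>2 * 16 * 1 \<le> \<eta>\<^sup>2 * (1 + v)\<^sup>2"
        using mult_mono[OF \<open>(v - 1)\<^sup>2 * 4 \<le> \<eta>\<^sup>2\<close> \<open>2 \<^sup>2 \<le> (1 + v)\<^sup>2\<close>] by simp
      moreover have "(1 + v)\<^sup>2 = (v - 1)\<^sup>2 + 4 * v"
        by (simp add: power2_eq_square algebra_simps)
      moreover have "(1 - \<eta>\<^sup>2 / 16) * (1 + v)\<^sup>2 = (1 + v)\<^sup>2 - \<eta>\<^sup>2 * (1 + v)\<^sup>2 / 16"
        by (simp add: algebra_simps)
      ultimately have "(1 - \<eta>\<^sup>2 / 16) * (1 + v)\<^sup>2 \<le> 4 * v"
        by linarith
      then have "1 - \<eta>\<^sup>2 / 16 \<le> 4 * v / (1 + v)\<^sup>2"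
        using v by (simp add: pos_le_divide_eq)
      then show ?thesis
        by (simp add: g_def v_def \<eta>(3))
    qed
    then have "y k * g \<le> y k * (4 * sqrt \<rho> / (1 + sqrt \<rho>)\<^sup>2)"
      using \<open>0 < y k\<close> by (intro mult_left_mono) auto
    ultimately have exponent: "g * y k \<le> 4 * y k * r * sqrt (\<rho> ^ k) / (r + sqrt (\<rho> ^ k))\<^sup>2"
      by (simp only: mult.commute)
    have "prob (A k) \<le> exp (- (4 * y k * r * sqrt (\<rho> ^ k) / (r + sqrt (\<rho> ^ k))\<^sup>2))"
      unfolding A_def r_def using \<rho> \<open>0 < y k\<close>
      by (intro subgaussian_slice[OF indep bounded mean]) auto
    also have "\<dots> \<le> exp (- (g * y k))"
      using exponent by simp
    also have "- (g * y k) = (1 / 2 + - x) + - (c * g) * ln (1 + real (k - 1) * ln \<rho>)"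
      using g(3) by (simp add: y_def algebra_simps)
    also have "exp \<dots> = sqrt (exp 1) * exp (- x) * (1 + real (k - 1) * ln \<rho>) powr - (c * g)"
    proof -
      have powr: "(1 + real (k - 1) * ln \<rho>) powr - (c * g) =
          exp (- (c * g) * ln (1 + real (k - 1) * ln \<rho>))"
        using ge1 by (simp add: powr_def)
      have "exp (1 / 2) = sqrt (exp 1 :: real)"
        by (rule real_sqrt_unique[symmetric]) (simp_all flip: exp_of_nat_mult)
      then show ?thesis
        using powr by (simp only: exp_add)
    qed
    \<comment> \<open>The exponent is not positive, so a smaller base gives a larger value. What
      remains is a pure power of \<open>k\<close>, to be summed.\<close>
    also have "\<dots> \<le> sqrt (exp 1) * exp (- x) * (real k * ln \<rho>) powr - (c * g)"
    proof -
      have "real k * ln \<rho> = ln \<rho> + real (k - 1) * ln \<rho>"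
        using \<open>1 \<le> k\<close> by (simp add: of_nat_diff algebra_simps)
      then have "real k * ln \<rho> \<le> 1 + real (k - 1) * ln \<rho>"
        using ln_\<rho> by simp
      then show ?thesis
        using \<open>1 \<le> k\<close> ln_\<rho> c g by (intro mult_left_mono powr_mono2') auto
    qed
    also have "(real k * ln \<rho>) powr - (c * g) = real k powr - (c * g) * (1 / ln \<rho>) powr (c * g)"
      using ln_\<rho> \<open>1 \<le> k\<close> by (simp add: powr_mult powr_minus powr_divide field_simps)
    also have "sqrt (exp 1) * exp (- x) * (real k powr - (c * g) * (1 / ln \<rho>) powr (c * g)) \<le>
        sqrt (exp 1) * exp (- x) * (real k powr - (c * g) * (sqrt x / (2 * sqrt 2) + 1) powr c)"
    proof -
      have "(1 / ln \<rho>) powr (c * g) \<le> (1 / ln \<rho>) powr c"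
        using ln_\<rho> c g by (intro powr_mono) (auto simp: mult_left_le)
      also have "\<dots> \<le> (sqrt x / (2 * sqrt 2) + 1) powr c"
        using ln_\<rho> c by (intro powr_mono2) auto
      finally show ?thesis
        by (intro mult_left_mono) auto
    qed
    finally show ?thesis
      by (simp add: mult_ac)
  qed
  have "?B \<subseteq> (\<Union>k\<in>J. A k)"
  proof
    fix \<omega> assume "\<omega> \<in> ?B"
    then obtain n where n: "n \<in> {1..N}" "\<omega> \<in> space M"
      "sqrt (real n * (x + c * ln (ln (exp 1 * real n))) / 2) \<le> (\<Sum>i<n. X i \<omega>)"
      by auto
    define m where "m = nat \<lfloor>log \<rho> (real n)\<rfloor>"
    have "0 \<le> log \<rho> (real n)"
      using n(1) \<rho> by simp
    then have m: "real m \<le> log \<rho> (real n)" "log \<rho> (real n) \<le> real (Suc m)"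
      unfolding m_def by linarith+
    have pow: "\<rho> ^ m \<le> real n" "real n \<le> \<rho> ^ Suc m"
      using m n(1) \<rho>
      by (simp_all add: le_log_iff log_le_iff powr_realpow del: power_Suc of_nat_Suc)
    have "real m * ln \<rho> = ln (\<rho> ^ m)"
      using \<rho> by (simp add: ln_realpow)
    also have "\<dots> \<le> ln (real n)"
      using pow(1) \<rho> n(1) by (subst ln_le_cancel_iff) auto
    finally have "1 + real m * ln \<rho> \<le> ln (exp 1 * real n)"
      using n(1) by (simp add: ln_mult)
    moreover have "0 < 1 + real m * ln \<rho>"
      using ln_\<rho> by (simp add: add_pos_nonneg)
    ultimately have "y (Suc m) \<le> x + c * ln (ln (exp 1 * real n))"
      unfolding y_def using c by (simp add: mult_left_mono)
    then have "sqrt (real n * y (Suc m) / 2) \<le> sqrt (real n * (x + c * ln (ln (exp 1 * real n))) / 2)"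
      by (intro real_sqrt_le_mono divide_right_mono mult_left_mono) auto
    also have "\<dots> \<le> (\<Sum>i<n. X i \<omega>)"
      by (rule n)
    finally have "\<omega> \<in> A (Suc m)"
      unfolding A_def using n pow \<rho> by (auto intro!: exI[of _ n])
    then show "\<omega> \<in> (\<Union>k\<in>J. A k)"
      using n(1) unfolding J_def m_def by auto
  qed
  then have "prob ?B \<le> prob (\<Union>k\<in>J. A k)"
    using A_meas by (intro finite_measure_mono) (auto simp: J_def)
  also have "\<dots> \<le> (\<Sum>k\<in>J. prob (A k))"
    using A_meas by (intro finite_measure_subadditive_finite) (auto simp: J_def)
  also have "\<dots> \<le> (\<Sum>k\<in>J. sqrt (exp 1) * (sqrt x / (2 * sqrt 2) + 1) powr c * exp (- x) *
      real k powr - (c * g))"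
    by (intro sum_mono A_le) (auto simp: J_def)
  also have "\<dots> = sqrt (exp 1) * (sqrt x / (2 * sqrt 2) + 1) powr c * exp (- x) *
      (\<Sum>k\<in>J. real k powr - (c * g))"
    by (simp add: sum_distrib_left)
  also have "\<dots> \<le> sqrt (exp 1) * (sqrt x / (2 * sqrt 2) + 1) powr c * exp (- x) * s"
    unfolding g_def by (intro mult_left_mono s) (auto simp: J_def)
  finally show ?thesis
    by (simp add: mult_ac)
qed

end


section \<open>Deviations of the Bernoulli arms\<close>

text \<open>Indexing by the draws of the arm instead of the rounds makes this a sum of independent
  terms, whatever the sampling rule does.\<close>

definition deviation :: "(arm \<Rightarrow> nat \<Rightarrow> bool) \<Rightarrow> (arm \<Rightarrow> real) \<Rightarrow> arm \<Rightarrow> nat \<Rightarrow> real" where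
  "deviation y \<mu> P n = (\<Sum>i<n. of_bool (y P i) - \<mu> P)"

text \<open>Injectivity makes the singletons \<open>{f j}\<close> disjoint blocks of indices, and
  functions of disjoint blocks are independent.\<close>

lemma (in prob_space) indep_vars_reindexed:
  assumes "indep_vars M' X I" "inj_on f J" "f ` J \<subseteq> I"
  shows "indep_vars (\<lambda>j. M' (f j)) (\<lambda>j. X (f j)) J"
proof -
  have "indep_vars (\<lambda>j. Pi\<^sub>M {f j} M') (\<lambda>j \<omega>. restrict (\<lambda>i. X i \<omega>) {f j}) J"
    using assms by (intro indep_vars_restrict) (auto simp: disjoint_family_on_def inj_on_def)
  then have "indep_vars (\<lambda>j. M' (f j)) (\<lambda>j \<omega>. (\<lambda>h. h (f j)) (restrict (\<lambda>i. X i \<omega>) {f j})) J"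
    by (rule indep_vars_compose2) (auto intro: measurable_component_singleton)
  then show ?thesis
    by simp
qed

section \<open>Tail bounds for one arm and for a pair of arms\<close>

locale bernoulli_arms = prob_space M for M :: "'w measure" +
  fixes A :: "arm set" and \<mu> :: "arm \<Rightarrow> real" and Y :: "arm \<Rightarrow> nat \<Rightarrow> 'w \<Rightarrow> bool"
  assumes draws: "bernoulli_draws M A \<mu> Y"
    and mean_bounds: "\<And>P. P \<in> A \<Longrightarrow> 0 \<le> \<mu> P \<and> \<mu> P \<le> 1"
begin

lemma measurable_draw [measurable]: "P \<in> A \<Longrightarrow> Y P n \<in> measurable M (count_space UNIV)"
  using draws by (force simp: bernoulli_draws_def indep_vars_def)

lemma measurable_deviation [measurable]:
  "P \<in> A \<Longrightarrow> (\<lambda>\<omega>. deviation (\<lambda>P n. Y P n \<omega>) \<mu> P n) \<in> borel_measurable M"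
  unfolding deviation_def by measurable

lemma expectation_draw:
  assumes "P \<in> A"
  shows "expectation (\<lambda>\<omega>. of_bool (Y P n \<omega>) :: real) = \<mu> P"
proof -
  have "expectation (\<lambda>\<omega>. of_bool (Y P n \<omega>) :: real) =
      (\<integral>b. of_bool b \<partial>distr M (count_space UNIV) (Y P n))"
    using assms by (subst integral_distr) auto
  also have "\<dots> = \<mu> P"
    using assms draws mean_bounds[OF assms]
    by (simp add: bernoulli_draws_def)
  finally show ?thesis .
qed

lemma integrable_draw: "P \<in> A \<Longrightarrow> integrable M (\<lambda>\<omega>. of_bool (Y P n \<omega>) :: real)"
  by (rule integrable_const_bound[where B = 1]) auto

text \<open>Weights and centres that vary with the index serve both a single arm with a fixed sign
  and two arms weighted by sample size.\<close>

lemma indep_rescaled_draws: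
  assumes "\<And>i. i \<in> I \<Longrightarrow> fst i \<in> A"
  shows "indep_vars (\<lambda>_. borel) (\<lambda>i \<omega>. u i * (of_bool (Y (fst i) (snd i) \<omega>) - v i) :: real) I"
proof -
  have "indep_vars (\<lambda>_. count_space UNIV) (\<lambda>(P, n). Y P n) I"
  proof (rule indep_vars_subset)
    show "indep_vars (\<lambda>_. count_space UNIV) (\<lambda>(P, n). Y P n) (A \<times> UNIV)"
      using draws by (simp add: bernoulli_draws_def)
    show "I \<subseteq> A \<times> UNIV"
      using assms by (auto simp: mem_Times_iff)
  qed
  then have "indep_vars (\<lambda>_. borel)
      (\<lambda>i \<omega>. (\<lambda>b. u i * (of_bool b - v i) :: real) ((\<lambda>(P, n). Y P n) i \<omega>)) I"
    by (rule indep_vars_compose2) simp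
  then show ?thesis
    by (simp add: case_prod_beta)
qed

text \<open>The sign \<open>u\<close> covers the upper and the lower tail at once. Either way the
  terms are centred and lie in an interval of length 1.\<close>

lemma deviation_tail:
  assumes "P \<in> A" "\<bar>u\<bar> = 1" "8 \<le> x" "0 \<le> c"
    and "\<And>J :: nat set. finite J \<Longrightarrow> 0 \<notin> J \<Longrightarrow>
      (\<Sum>k\<in>J. real k powr - (c * (1 - 1 / (2 * x)))) \<le> s"
  shows "prob {\<omega> \<in> space M. \<exists>n\<in>{1..N}. sqrt (real n * (x + c * ln (ln (exp 1 * real n))) / 2)
        \<le> u * deviation (\<lambda>P n. Y P n \<omega>) \<mu> P n}
      \<le> sqrt (exp 1) * s * (sqrt x / (2 * sqrt 2) + 1) powr c * exp (- x)"
proof -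
  define X where "X n \<omega> = u * (of_bool (Y P n \<omega>) - \<mu> P)" for n \<omega>
  have "indep_vars (\<lambda>_. borel) (\<lambda>i \<omega>. u * (of_bool (Y (fst i) (snd i) \<omega>) - \<mu> P)) ({P} \<times> UNIV)"
    using \<open>P \<in> A\<close> by (intro indep_rescaled_draws) auto
  then have "indep_vars (\<lambda>_. borel) (\<lambda>n. (\<lambda>i \<omega>. u * (of_bool (Y (fst i) (snd i) \<omega>) - \<mu> P)) (Pair P n)) UNIV"
    by (rule indep_vars_reindexed) (auto intro: inj_onI)
  then have "indep_vars (\<lambda>_. borel) X UNIV"
    by (simp add: X_def [abs_def])
  moreover have "AE \<omega> in M. X i \<omega> \<in> {min (u * (0 - \<mu> P)) (u * (1 - \<mu> P)) ..
      min (u * (0 - \<mu> P)) (u * (1 - \<mu> P)) + 1}" for i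
  proof (intro AE_I2)
    fix \<omega>
    have "u = 1 \<or> u = - 1"
      using \<open>\<bar>u\<bar> = 1\<close> by linarith
    then show "X i \<omega> \<in> {min (u * (0 - \<mu> P)) (u * (1 - \<mu> P)) ..
        min (u * (0 - \<mu> P)) (u * (1 - \<mu> P)) + 1}"
      by (cases "Y P i \<omega>") (auto simp: X_def)
  qed
  moreover have "expectation (X i) = 0" for i
    using expectation_draw[OF \<open>P \<in> A\<close>] integrable_draw[OF \<open>P \<in> A\<close>]
    by (simp add: X_def [abs_def] prob_space)
  moreover have "u * deviation (\<lambda>P n. Y P n \<omega>) \<mu> P n = (\<Sum>i<n. X i \<omega>)" for n \<omega>
    by (simp add: deviation_def X_def sum_distrib_left)
  ultimately show ?thesis
    using subgaussian_uniform_deviation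
      [of X "\<lambda>_. min (u * (0 - \<mu> P)) (u * (1 - \<mu> P))" x c s N] assms(3-) by simp
qed

lemma two_sided_deviation_tail:
  assumes "P \<in> A" "8 \<le> x" "0 \<le> c"
    and "\<And>J :: nat set. finite J \<Longrightarrow> 0 \<notin> J \<Longrightarrow>
      (\<Sum>k\<in>J. real k powr - (c * (1 - 1 / (2 * x)))) \<le> s"
  shows "prob {\<omega> \<in> space M. \<exists>n\<in>{1..N}. sqrt (real n * (x + c * ln (ln (exp 1 * real n))) / 2)
        \<le> \<bar>deviation (\<lambda>P n. Y P n \<omega>) \<mu> P n\<bar>}
      \<le> 2 * (sqrt (exp 1) * s * (sqrt x / (2 * sqrt 2) + 1) powr c * exp (- x))"
    (is "prob ?B \<le> 2 * ?p")
proof -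
  define B where "B u = {\<omega> \<in> space M. \<exists>n\<in>{1..N}.
      sqrt (real n * (x + c * ln (ln (exp 1 * real n))) / 2)
        \<le> u * deviation (\<lambda>P n. Y P n \<omega>) \<mu> P n}" for u
  have [measurable]: "B u \<in> sets M" for u
    unfolding B_def using \<open>P \<in> A\<close> by measurable
  have "?B \<subseteq> B 1 \<union> B (- 1)"
    unfolding B_def abs_real_def by (auto split: if_splits)
  then have "prob ?B \<le> prob (B 1 \<union> B (- 1))"
    by (intro finite_measure_mono) auto
  also have "\<dots> \<le> prob (B 1) + prob (B (- 1))"
    by (intro measure_Un_le) auto
  also have "\<dots> \<le> ?p + ?p"
    unfolding B_def using assms by (intro add_mono deviation_tail) auto
  finally show ?thesis
    by (simp only: mult_2)
qed

text \<open>Normalising both samples by the square roots of their sizes makes the exponents add up.\<close>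

lemma joint_deviation_tail:
  assumes "P \<in> A" "Q \<in> A" "P \<noteq> Q" "0 < n" "0 < m" "0 \<le> \<epsilon>"
  shows "prob {\<omega> \<in> space M. sqrt (real n) * \<epsilon> \<le> - deviation (\<lambda>P n. Y P n \<omega>) \<mu> P n \<and>
      sqrt (real m) * \<epsilon> \<le> deviation (\<lambda>P n. Y P n \<omega>) \<mu> Q m} \<le> exp (- (4 * \<epsilon>\<^sup>2))"
    (is "prob ?B \<le> _")
proof -
  define I where "I = Pair P ` {..<n} \<union> Pair Q ` {..<m}"
  \<comment> \<open>The minus sign belongs to \<open>P\<close> because its deviation is
    downwards.\<close>
  define u where "u i = (if fst i = P then - (1 / sqrt (real n)) else 1 / sqrt (real m))" for i :: "arm \<times> nat"
  define X where "X i \<omega> = u i * (of_bool (Y (fst i) (snd i) \<omega>) - \<mu> (fst i))" for i \<omega>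
  define lo where "lo i = min (u i * (0 - \<mu> (fst i))) (u i * (1 - \<mu> (fst i)))" for i
  define hi where "hi i = max (u i * (0 - \<mu> (fst i))) (u i * (1 - \<mu> (fst i)))" for i
  have A: "fst i \<in> A" if "i \<in> I" for i
    using that assms by (auto simp: I_def)
  have mean: "expectation (X i) = 0" if "i \<in> I" for i
    using expectation_draw[OF A[OF that]] integrable_draw[OF A[OF that]]
    by (simp add: X_def [abs_def] prob_space)
  interpret H: Hoeffding_ineq M I X lo hi 0
  proof unfold_locales
    show "finite I"
      by (simp add: I_def)
    show "indep_vars (\<lambda>_. borel) X I"
      unfolding X_def [abs_def] by (intro indep_rescaled_draws A)
    show "AE \<omega> in M. X i \<omega> \<in> {lo i..hi i}" for i
      by (intro AE_I2) (auto simp: X_def lo_def hi_def)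
    show "0 \<equiv> \<Sum>i\<in>I. expectation (X i)"
      using mean by simp
  qed
  have split: "(\<Sum>i\<in>I. f i) = (\<Sum>k<n. f (P, k)) + (\<Sum>k<m. f (Q, k))" for f :: "arm \<times> nat \<Rightarrow> real"
  proof -
    have inj: "inj_on (Pair R) J" for R :: arm and J :: "nat set"
      by (simp add: inj_on_def)
    have "Pair P ` {..<n} \<inter> Pair Q ` {..<m} = {}"
      using \<open>P \<noteq> Q\<close> by blast
    then have "(\<Sum>i\<in>I. f i) = sum f (Pair P ` {..<n}) + sum f (Pair Q ` {..<m})"
      unfolding I_def by (intro sum.union_disjoint) simp_all
    then show ?thesis
      by (simp add: sum.reindex[OF inj] comp_def)
  qed
  have "(hi i - lo i)\<^sup>2 = (u i)\<^sup>2" for i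
    by (auto simp: hi_def lo_def min_def max_def algebra_simps power2_commute)
  \<comment> \<open>The squared weights sum to 1 over each sample. With this denominator 2, the
    level \<open>2 * \<epsilon>\<close> gives Hoeffding's exponent
    \<open>- (4 * \<epsilon>\<^sup>2)\<close>.\<close>
  then have len: "(\<Sum>i\<in>I. (hi i - lo i)\<^sup>2) = 2"
    using assms by (simp add: split u_def power_divide)
  have [measurable]: "X i \<in> borel_measurable M" if "i \<in> I" for i
    using A[OF that] unfolding X_def by measurable
  have "?B \<subseteq> {\<omega> \<in> space M. 0 + 2 * \<epsilon> \<le> (\<Sum>i\<in>I. X i \<omega>)}"
  proof safe
    fix \<omega>
    assume dev: "sqrt (real n) * \<epsilon> \<le> - deviation (\<lambda>P n. Y P n \<omega>) \<mu> P n"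
      "sqrt (real m) * \<epsilon> \<le> deviation (\<lambda>P n. Y P n \<omega>) \<mu> Q m"
    have "(\<Sum>i\<in>I. X i \<omega>) = - deviation (\<lambda>P n. Y P n \<omega>) \<mu> P n / sqrt (real n) +
        deviation (\<lambda>P n. Y P n \<omega>) \<mu> Q m / sqrt (real m)"
      using \<open>P \<noteq> Q\<close>
      by (simp add: split X_def u_def deviation_def sum_divide_distrib sum_negf flip: sum_distrib_left)
    moreover have "\<epsilon> \<le> - deviation (\<lambda>P n. Y P n \<omega>) \<mu> P n / sqrt (real n)"
      "\<epsilon> \<le> deviation (\<lambda>P n. Y P n \<omega>) \<mu> Q m / sqrt (real m)"
      using dev assms
      by (simp_all only: pos_le_divide_eq mult.commute real_sqrt_gt_0_iff of_nat_0_less_iff)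
    ultimately show "0 + 2 * \<epsilon> \<le> (\<Sum>i\<in>I. X i \<omega>)"
      by simp
  qed
  then have "prob ?B \<le> prob {\<omega> \<in> space M. 0 + 2 * \<epsilon> \<le> (\<Sum>i\<in>I. X i \<omega>)}"
    by (intro finite_measure_mono) auto
  also have "\<dots> \<le> exp (- 2 * (2 * \<epsilon>)\<^sup>2 / (\<Sum>i\<in>I. (hi i - lo i)\<^sup>2))"
    using \<open>0 \<le> \<epsilon>\<close> len by (intro H.Hoeffding_ineq_ge) auto
  finally show ?thesis
    by (simp add: len power_mult_distrib)
qed

text \<open>The second condition fails only if \<open>P\<close> deviates downwards and
  \<open>Q\<close> upwards for some pair of sample sizes, an event with doubled exponent. The
  horizon \<open>T\<close> keeps the union bound over these pairs finite.\<close>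

definition good_event :: "real \<Rightarrow> real \<Rightarrow> real \<Rightarrow> arm \<Rightarrow> arm \<Rightarrow> nat \<Rightarrow> 'w set" where
  "good_event x c \<epsilon> P Q T = {\<omega> \<in> space M.
     (\<forall>R\<in>A. \<forall>n\<in>{1..T}. \<bar>deviation (\<lambda>P n. Y P n \<omega>) \<mu> R n\<bar> <
        sqrt (real n * (x + c * ln (ln (exp 1 * real n))) / 2)) \<and>
     ((\<forall>n\<in>{1..T}. - deviation (\<lambda>P n. Y P n \<omega>) \<mu> P n < sqrt (real n) * \<epsilon>) \<or>
      (\<forall>n\<in>{1..T}. deviation (\<lambda>P n. Y P n \<omega>) \<mu> Q n < sqrt (real n) * \<epsilon>))}"

text \<open>Union bound over the arms for the intervals, and over the \<open>T\<^sup>2\<close> pairs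
  of sample sizes for the joint deviations.\<close>

lemma good_event_prob:
  assumes "finite A" "P \<in> A" "Q \<in> A" "P \<noteq> Q" "8 \<le> x" "0 \<le> c" "0 \<le> \<epsilon>"
    and "\<And>J :: nat set. finite J \<Longrightarrow> 0 \<notin> J \<Longrightarrow>
      (\<Sum>k\<in>J. real k powr - (c * (1 - 1 / (2 * x)))) \<le> s"
  shows "1 - (real (card A) * (2 * (sqrt (exp 1) * s * (sqrt x / (2 * sqrt 2) + 1) powr c * exp (- x))) +
        (real T)\<^sup>2 * exp (- (4 * \<epsilon>\<^sup>2))) \<le> prob (good_event x c \<epsilon> P Q T)"
proof -
  define B where "B R = {\<omega> \<in> space M. \<exists>n\<in>{1..T}.
      sqrt (real n * (x + c * ln (ln (exp 1 * real n))) / 2)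
        \<le> \<bar>deviation (\<lambda>P n. Y P n \<omega>) \<mu> R n\<bar>}" for R
  define D where "D k = {\<omega> \<in> space M.
      sqrt (real (fst k)) * \<epsilon> \<le> - deviation (\<lambda>P n. Y P n \<omega>) \<mu> P (fst k) \<and>
      sqrt (real (snd k)) * \<epsilon> \<le> deviation (\<lambda>P n. Y P n \<omega>) \<mu> Q (snd k)}" for k
  have B_meas: "B R \<in> events" if "R \<in> A" for R
    unfolding B_def using that by measurable
  have D_meas: "D k \<in> events" for k
    unfolding D_def using assms by measurable
  have B_UN: "(\<Union>R\<in>A. B R) \<in> events"
    using B_meas \<open>finite A\<close> by auto
  have D_UN: "(\<Union>k\<in>{1..T} \<times> {1..T}. D k) \<in> events"
    using D_meas by auto
  have good: "good_event x c \<epsilon> P Q T = space M - ((\<Union>R\<in>A. B R) \<union> (\<Union>k\<in>{1..T} \<times> {1..T}. D k))"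
  proof -
    \<comment> \<open>A disjunction of two uniform statements becomes one statement about pairs,
      whose negation is a union of the events \<open>D k\<close>.\<close>
    have either: "(\<forall>n\<in>J. a n) \<or> (\<forall>n\<in>J. b n) \<longleftrightarrow> (\<forall>k\<in>J \<times> J. a (fst k) \<or> b (snd k))"
      for a b :: "nat \<Rightarrow> bool" and J
      by auto
    have "\<omega> \<in> good_event x c \<epsilon> P Q T \<longleftrightarrow>
        \<omega> \<in> space M \<and> (\<forall>R\<in>A. \<omega> \<notin> B R) \<and> (\<forall>k\<in>{1..T} \<times> {1..T}. \<omega> \<notin> D k)" for \<omega>
    proof (cases "\<omega> \<in> space M")
      case True
      then have B: "\<omega> \<notin> B R \<longleftrightarrow> (\<forall>n\<in>{1..T}. \<bar>deviation (\<lambda>P n. Y P n \<omega>) \<mu> R n\<bar> <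
          sqrt (real n * (x + c * ln (ln (exp 1 * real n))) / 2))" for R
        by (auto simp: B_def not_le)
      have D: "\<omega> \<notin> D k \<longleftrightarrow> - deviation (\<lambda>P n. Y P n \<omega>) \<mu> P (fst k) < sqrt (real (fst k)) * \<epsilon> \<or>
          deviation (\<lambda>P n. Y P n \<omega>) \<mu> Q (snd k) < sqrt (real (snd k)) * \<epsilon>" for k
        using True by (auto simp: D_def not_le)
      show ?thesis
        unfolding B D good_event_def mem_Collect_eq either by (simp only: True simp_thms)
    qed (simp add: good_event_def)
    then show ?thesis
      by blast
  qed
  have "prob ((\<Union>R\<in>A. B R) \<union> (\<Union>k\<in>{1..T} \<times> {1..T}. D k)) \<le>
      prob (\<Union>R\<in>A. B R) + prob (\<Union>k\<in>{1..T} \<times> {1..T}. D k)"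
    using B_UN D_UN by (rule measure_Un_le)
  also have "\<dots> \<le> (\<Sum>R\<in>A. prob (B R)) + (\<Sum>k\<in>{1..T} \<times> {1..T}. prob (D k))"
    using B_meas D_meas \<open>finite A\<close> by (intro add_mono finite_measure_subadditive_finite) auto
  also have "\<dots> \<le> (\<Sum>R\<in>A. 2 * (sqrt (exp 1) * s * (sqrt x / (2 * sqrt 2) + 1) powr c * exp (- x))) +
      (\<Sum>k\<in>{1..T} \<times> {1..T}. exp (- (4 * \<epsilon>\<^sup>2)))"
  proof (intro add_mono sum_mono)
    show "prob (B R) \<le> 2 * (sqrt (exp 1) * s * (sqrt x / (2 * sqrt 2) + 1) powr c * exp (- x))"
      if "R \<in> A" for R
      unfolding B_def by (rule two_sided_deviation_tail[OF that assms(5,6,8)])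
    show "prob (D k) \<le> exp (- (4 * \<epsilon>\<^sup>2))" if "k \<in> {1..T} \<times> {1..T}" for k
      unfolding D_def using that
      by (intro joint_deviation_tail[OF assms(2-4) _ _ assms(7)]) auto
  qed
  also have "\<dots> = real (card A) * (2 * (sqrt (exp 1) * s * (sqrt x / (2 * sqrt 2) + 1) powr c * exp (- x))) +
      (real T)\<^sup>2 * exp (- (4 * \<epsilon>\<^sup>2))"
    by (simp add: power2_eq_square)
  finally show ?thesis
    unfolding good using B_UN D_UN by (subst prob_compl) (simp_all add: sets.Un)
qed

end


section \<open>M-LUCB on a concentrated sample\<close>

lemma length_play [simp]: "length (play a y t) = t"
  by (induction t) (simp_all add: Let_def)

lemma num_draws_append [simp]: "num_draws (h @ h') Q = num_draws h Q + num_draws h' Q"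
  by (simp add: num_draws_def)

lemma num_draws_Cons [simp]: "num_draws ((P, x) # h) Q = of_bool (P = Q) + num_draws h Q"
  by (simp add: num_draws_def)

lemma num_draws_Nil [simp]: "num_draws [] Q = 0"
  by (simp add: num_draws_def)

lemma num_draws_le_length: "num_draws h P \<le> length h"
  by (induction h rule: rev_induct) (auto simp: of_bool_def)

lemma num_draws_play_mono: "s \<le> t \<Longrightarrow> num_draws (play a y s) P \<le> num_draws (play a y t) P"
  by (induction rule: dec_induct) (auto simp: Let_def intro: le_trans)

lemma reward_play:
  "(\<Sum>(Q, x)\<leftarrow>play a y t. of_bool x * of_bool (Q = P)) =
     (\<Sum>i<num_draws (play a y t) P. of_bool (y P i) :: real)"
  by (induction t) (auto simp: Let_def simp del: sum_of_bool_eq)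

lemma emp_mean_play:
  assumes "0 < num_draws (play a y t) P"
  shows "emp_mean m0 (play a y t) P =
    \<mu> P + deviation y \<mu> P (num_draws (play a y t) P) / real (num_draws (play a y t) P)"
  using assms by (simp add: emp_mean_def reward_play deviation_def sum_subtractf field_simps)

lemma ereal_diff_less_0_iff:
  fixes a b :: ereal
  assumes "a \<noteq> - \<infinity> \<or> b \<noteq> - \<infinity>" "b \<noteq> \<infinity>"
  shows "a - b < 0 \<longleftrightarrow> a < b"
  using assms by (cases a; cases b) auto

lemma lcb_not_PInf [simp]: "lcb \<beta> m0 h P \<noteq> \<infinity>"
  by (simp add: lcb_def)

lemma finite_arms: "finite (arms K Ks)"
proof -
  have "arms K Ks = (SIGMA i:{1..K}. {1..Ks i})"
    by (auto simp: arms_def)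
  then show ?thesis
    by simp
qed

lemma card_arms: "card (arms K Ks) = (\<Sum>i=1..K. Ks i)"
proof -
  have "arms K Ks = (SIGMA i:{1..K}. {1..Ks i})"
    by (auto simp: arms_def)
  then show ?thesis
    by simp
qed

text \<open>Without the infimum, stopping at \<open>t\<close> is a condition on the histories up to
  time \<open>t\<close>. This form serves measurability as well as the bound on the time.\<close>

lemma mlucb_time_eq_enat_iff:
  "mlucb_time K Ks \<beta> m0 hist = enat t \<longleftrightarrow>
     (even t \<and> mlucb_stops K Ks \<beta> m0 (hist t)) \<and>
     (\<forall>s<t. \<not> (even s \<and> mlucb_stops K Ks \<beta> m0 (hist s)))"
proof -
  let ?P = "\<lambda>t. even t \<and> mlucb_stops K Ks \<beta> m0 (hist t)"
  have Least: "(INF t\<in>{t. ?P t}. enat t) = enat (LEAST t. ?P t)" if "?P s" for s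
  proof (rule antisym)
    show "(INF t\<in>{t. ?P t}. enat t) \<le> enat (LEAST t. ?P t)"
      using LeastI[of ?P, OF that] by (intro INF_lower) auto
    show "enat (LEAST t. ?P t) \<le> (INF t\<in>{t. ?P t}. enat t)"
      by (rule INF_greatest) (auto intro: Least_le)
  qed
  show ?thesis
  proof
    assume time: "mlucb_time K Ks \<beta> m0 hist = enat t"
    then obtain s where "?P s"
      unfolding mlucb_time_def by (cases "{t. ?P t} = {}") (auto simp: top_enat_def)
    then have "t = (LEAST t. ?P t)"
      using time Least[of s] unfolding mlucb_time_def by simp
    then show "?P t \<and> (\<forall>s<t. \<not> ?P s)"
      using LeastI[of ?P, OF \<open>?P s\<close>] not_less_Least[of _ ?P] by blast
  next
    assume *: "?P t \<and> (\<forall>s<t. \<not> ?P s)"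
    then have "(LEAST t. ?P t) = t"
      by (intro Least_equality) (auto simp: not_less[symmetric])
    then show "mlucb_time K Ks \<beta> m0 hist = enat t"
      using * Least[of t] unfolding mlucb_time_def by simp
  qed
qed

section \<open>Gaps of the game and a lower bound on \<open>H_star\<close>\<close>

locale maximin_game =
  fixes K :: nat and Ks :: "nat \<Rightarrow> nat" and \<mu> :: "arm \<Rightarrow> real"
  assumes bandit: "bandit_instance K Ks \<mu>"
    and labels: "ordered_labels K Ks \<mu>"
    and unique: "\<mu> (2, 1) < \<mu> (1, 1)"
begin

text \<open>The threshold that separates the value of action 1 from the values of all other
  actions.\<close>

definition mid :: real where
  "mid = (\<mu> (1, 1) + \<mu> (2, 1)) / 2"

definition gap :: "arm \<Rightarrow> real" where
  "gap P = max ((\<mu> (fst P, 1) - mid)\<^sup>2) ((\<mu> P - \<mu> (fst P, 1))\<^sup>2)"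

lemma K_ge_2: "2 \<le> K" and Ks_ge_1: "i \<in> {1..K} \<Longrightarrow> 1 \<le> Ks i"
  using bandit by (auto simp: bandit_instance_def)

lemma arms_iff: "(i, j) \<in> arms K Ks \<longleftrightarrow> i \<in> {1..K} \<and> j \<in> {1..Ks i}"
  by (simp add: arms_def)

lemma first_arm: "i \<in> {1..K} \<Longrightarrow> (i, 1) \<in> arms K Ks"
  using Ks_ge_1[of i] by (simp add: arms_iff)

lemma one_in: "1 \<in> {1..K}" and two_in: "2 \<in> {1..K}"
  using K_ge_2 by auto

lemma mid_less: "mid < \<mu> (1, 1)" and less_mid: "\<mu> (2, 1) < mid"
  using unique by (simp_all add: mid_def)

lemma first_le:
  assumes "(i, j) \<in> arms K Ks"
  shows "\<mu> (i, 1) \<le> \<mu> (i, j)"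
proof -
  have "mono_on {1..Ks i} (\<lambda>j. \<mu> (i, j))"
    using labels assms unfolding ordered_labels_def arms_iff by blast
  then show ?thesis
    by (rule monotone_onD) (use assms in \<open>auto simp: arms_iff\<close>)
qed

lemma other_less_mid:
  assumes "i \<in> {1..K}" "i \<noteq> 1"
  shows "\<mu> (i, 1) < mid"
proof -
  have "antimono_on {1..K} (\<lambda>i. \<mu> (i, 1))"
    using labels by (simp add: ordered_labels_def)
  then have "\<mu> (i, 1) \<le> \<mu> (2, 1)"
    by (rule monotone_onD) (use assms two_in in auto)
  with less_mid show ?thesis
    by linarith
qed

lemma gap_pos: "P \<in> arms K Ks \<Longrightarrow> 0 < gap P"
proof -
  assume "P \<in> arms K Ks"
  then have "fst P \<in> {1..K}"
    by (auto simp: arms_def)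
  then have "\<mu> (fst P, 1) \<noteq> mid"
    using other_less_mid[of "fst P"] mid_less by (cases "fst P = 1") auto
  then have "0 < (\<mu> (fst P, 1) - mid)\<^sup>2"
    by simp
  then show ?thesis
    by (simp add: gap_def less_max_iff_disj)
qed

lemma first_arms: "(1, 1) \<in> arms K Ks" "(2, 1) \<in> arms K Ks"
  using first_arm[OF one_in] first_arm[OF two_in] .

lemma gap_first_arms: "gap (1, 1) = (\<mu> (1, 1) - mid)\<^sup>2" "gap (2, 1) = (\<mu> (1, 1) - mid)\<^sup>2"
proof -
  have "\<mu> (2, 1) - mid = - (\<mu> (1, 1) - mid)"
    by (simp add: mid_def field_simps)
  then have "(\<mu> (2, 1) - mid)\<^sup>2 = (\<mu> (1, 1) - mid)\<^sup>2"
    by (simp only: power2_minus)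
  then show "gap (1, 1) = (\<mu> (1, 1) - mid)\<^sup>2" "gap (2, 1) = (\<mu> (1, 1) - mid)\<^sup>2"
    by (simp_all add: gap_def)
qed

text \<open>Means in the unit interval put the midpoint within \<open>1 / 2\<close> of
  \<open>\<mu> (1, 1)\<close>. This yields both \<open>H_star_ge\<close> and the saving in
  \<open>stops_early\<close>.\<close>

lemma gap_first_arms_le: "gap (1, 1) \<le> 1 / 4"
proof -
  have "0 \<le> \<mu> (2, 1)" "\<mu> (1, 1) \<le> 1"
    using bandit first_arms by (auto simp: bandit_instance_def)
  then have "\<mu> (1, 1) - mid \<le> 1 / 2"
    by (simp add: mid_def field_simps)
  then have "(\<mu> (1, 1) - mid)\<^sup>2 \<le> (1 / 2)\<^sup>2"
    using mid_less by (intro power_mono) auto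
  then show ?thesis
    unfolding gap_first_arms by (simp add: power2_eq_square)
qed

lemma H_star_gap: "H_star K Ks \<mu> = (\<Sum>P\<in>arms K Ks. 1 / gap P)"
  by (simp add: H_star_def gap_def mid_def case_prod_beta)

lemma H_star_ge: "4 \<le> H_star K Ks \<mu>"
proof -
  have "4 \<le> 1 / gap (1, 1)"
    using gap_first_arms_le gap_pos[OF first_arms(1)] by (simp add: pos_le_divide_eq)
  also have "\<dots> \<le> H_star K Ks \<mu>"
    unfolding H_star_gap using gap_pos first_arms finite_arms
    by (intro member_le_sum) (auto intro: less_imp_le)
  finally show ?thesis .
qed

end

section \<open>One run with fixed choice functions and outcomes: the sampling and stopping
  rules\<close>

locale mlucb = maximin_game K Ks \<mu> for K Ks \<mu> +
  fixes \<beta> :: "nat \<Rightarrow> real" and m0 :: "arm \<Rightarrow> nat \<Rightarrow> real" and ih :: "history \<Rightarrow> nat"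
    and cc :: "history \<Rightarrow> nat \<Rightarrow> nat" and S :: "history \<Rightarrow> arm" and y :: "arm \<Rightarrow> nat \<Rightarrow> bool"
  assumes choices: "mlucb_choices K Ks \<beta> m0 ih cc S"
begin

abbreviation hist :: "nat \<Rightarrow> history" where
  "hist \<equiv> play (mlucb_next ih cc S) y"

lemma cc_arms: "even (length h) \<Longrightarrow> i \<in> {1..K} \<Longrightarrow> (i, cc h i) \<in> arms K Ks"
  using choices by (auto simp: mlucb_choices_def is_arg_min_def arms_iff)

lemma lcb_cc_le:
  "even (length h) \<Longrightarrow> (i, j) \<in> arms K Ks \<Longrightarrow> lcb \<beta> m0 h (i, cc h i) \<le> lcb \<beta> m0 h (i, j)"
  using choices by (auto simp: mlucb_choices_def is_arg_min_def arms_iff not_less)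

lemma ih_in: "even (length h) \<Longrightarrow> ih h \<in> {1..K}"
  using choices unfolding mlucb_choices_def is_arg_max_def by blast

lemma ih_max:
  "even (length h) \<Longrightarrow> i \<in> {1..K} \<Longrightarrow>
    (MIN j\<in>{1..Ks i}. emp_mean m0 h (i, j)) \<le> (MIN j\<in>{1..Ks (ih h)}. emp_mean m0 h (ih h, j))"
  using choices unfolding mlucb_choices_def is_arg_max_def by (meson not_less)

lemma S_eq: "even (length h) \<Longrightarrow> \<exists>i\<in>{1..K} - {ih h}. S h = (i, cc h i)"
  using choices unfolding mlucb_choices_def is_arg_max_def by blast

lemma S_max:
  "even (length h) \<Longrightarrow> i \<in> {1..K} - {ih h} \<Longrightarrow> ucb \<beta> m0 h (i, cc h i) \<le> ucb \<beta> m0 h (S h)"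
  using choices unfolding mlucb_choices_def is_arg_max_def by (meson not_less imageI)

lemma next_arms: "mlucb_next ih cc S h \<in> arms K Ks"
proof (cases "even (length h)")
  case True
  then show ?thesis
    using cc_arms[OF True ih_in[OF True]] by (simp add: mlucb_next_def)
next
  case False
  then have even: "even (length (butlast h))"
    by (cases h) auto
  from S_eq[OF even] obtain i where "i \<in> {1..K}" "S (butlast h) = (i, cc (butlast h) i)"
    by blast
  with cc_arms[OF even] False show ?thesis
    by (simp add: mlucb_next_def)
qed

text \<open>Otherwise the leader \<open>ih h\<close> would be a witness for stopping:
  \<open>S_max\<close> controls the maximum over the other actions and \<open>lcb_cc_le\<close> the
  minimum over the leader's own answers.\<close>

lemma not_stops_overlap:
  assumes even: "even (length h)" and "\<not> mlucb_stops K Ks \<beta> m0 h"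
  shows "lcb \<beta> m0 h (ih h, cc h (ih h)) \<le> ucb \<beta> m0 h (S h)"
proof (rule ccontr)
  let ?i = "ih h"
  let ?a = "MAX i'\<in>{1..K} - {?i}. MIN j'\<in>{1..Ks i'}. ucb \<beta> m0 h (i', j')"
  let ?b = "MIN j\<in>{1..Ks ?i}. lcb \<beta> m0 h (?i, j)"
  assume "\<not> lcb \<beta> m0 h (?i, cc h ?i) \<le> ucb \<beta> m0 h (S h)"
  then have less: "ucb \<beta> m0 h (S h) < lcb \<beta> m0 h (?i, cc h ?i)"
    by simp
  have "{1..K} - {?i} \<noteq> {}"
    using S_eq[OF even] by blast
  moreover have "(MIN j'\<in>{1..Ks i'}. ucb \<beta> m0 h (i', j')) \<le> ucb \<beta> m0 h (S h)"
    if "i' \<in> {1..K} - {?i}" for i'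
  proof -
    have "(MIN j'\<in>{1..Ks i'}. ucb \<beta> m0 h (i', j')) \<le> ucb \<beta> m0 h (i', cc h i')"
      using cc_arms[OF even, of i'] that by (intro Min_le) (auto simp: arms_iff)
    also have "\<dots> \<le> ucb \<beta> m0 h (S h)"
      by (rule S_max[OF even that])
    finally show ?thesis .
  qed
  ultimately have "?a \<le> ucb \<beta> m0 h (S h)"
    by (subst Max_le_iff) auto
  also note less
  also have "lcb \<beta> m0 h (?i, cc h ?i) \<le> ?b"
    using lcb_cc_le[OF even, of ?i] ih_in[OF even] Ks_ge_1[of ?i] by (subst Min_ge_iff) (auto simp: arms_iff)
  finally have "?a < ?b" .
  moreover have "?b \<noteq> \<infinity>"
  proof -
    have "?b \<le> lcb \<beta> m0 h (?i, cc h ?i)"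
      using cc_arms[OF even ih_in[OF even]] by (intro Min_le) (auto simp: arms_iff)
    then show ?thesis
      using lcb_not_PInf[of \<beta> m0 h "(?i, cc h ?i)"] by (metis ereal_infty_less_eq(1))
  qed
  ultimately have "?a - ?b < 0"
    by (subst ereal_diff_less_0_iff) auto
  then have "mlucb_stops K Ks \<beta> m0 h"
    unfolding mlucb_stops_def using ih_in[OF even] by (subst Min_less_iff) blast+
  with assms(2) show False
    by contradiction
qed

text \<open>Turns the extrema of the stopping rule into witnesses. The separating action is not yet
  known to be the recommended one; \<open>stops_correct\<close> settles this.\<close>

lemma stops_separated:
  assumes "mlucb_stops K Ks \<beta> m0 h"
  obtains i where "i \<in> {1..K}"
    "\<And>i'. i' \<in> {1..K} - {i} \<Longrightarrow> \<exists>j'\<in>{1..Ks i'}. \<forall>j\<in>{1..Ks i}. ucb \<beta> m0 h (i', j') < lcb \<beta> m0 h (i, j)"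
proof -
  have "{1..K} \<noteq> {}"
    using K_ge_2 by simp
  then obtain i where i: "i \<in> {1..K}" and
    neg: "(MAX i'\<in>{1..K} - {i}. MIN j'\<in>{1..Ks i'}. ucb \<beta> m0 h (i', j')) -
      (MIN j\<in>{1..Ks i}. lcb \<beta> m0 h (i, j)) < 0" (is "?a - ?b < 0")
    using assms unfolding mlucb_stops_def by (subst (asm) Min_less_iff) auto
  have "?a < ?b"
    using neg by (cases ?a; cases ?b) auto
  have "\<exists>j'\<in>{1..Ks i'}. \<forall>j\<in>{1..Ks i}. ucb \<beta> m0 h (i', j') < lcb \<beta> m0 h (i, j)"
    if i': "i' \<in> {1..K} - {i}" for i'
  proof -
    have "(MIN j'\<in>{1..Ks i'}. ucb \<beta> m0 h (i', j')) \<in> (\<lambda>j'. ucb \<beta> m0 h (i', j')) ` {1..Ks i'}"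
      using Ks_ge_1[of i'] i' by (intro Min_in) auto
    then obtain j' where j': "j' \<in> {1..Ks i'}"
      "(MIN j'\<in>{1..Ks i'}. ucb \<beta> m0 h (i', j')) = ucb \<beta> m0 h (i', j')"
      by auto
    have "ucb \<beta> m0 h (i', j') \<le> ?a"
      using i' by (subst j'(2)[symmetric]) (intro Max_ge, auto)
    moreover have "?b \<le> lcb \<beta> m0 h (i, j)" if "j \<in> {1..Ks i}" for j
      using that by (intro Min_le) auto
    ultimately show ?thesis
      using \<open>?a < ?b\<close> j'(1) by (meson le_less_trans less_le_trans)
  qed
  with i show thesis
    by (rule that)
qed

text \<open>At the odd time in between, \<open>mlucb_next\<close> drops the last entry of the
  history, so the history at the even time determines both draws.\<close>

lemma hist_double_Suc:
  "num_draws (hist (2 * Suc k)) P = num_draws (hist (2 * k)) P +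
     of_bool ((ih (hist (2 * k)), cc (hist (2 * k)) (ih (hist (2 * k)))) = P) +
     of_bool (S (hist (2 * k)) = P)"
  by (simp add: Let_def mlucb_next_def)

end

text \<open>The deviation at sample size \<open>n\<close> is compared with \<open>\<beta> n\<close>,
  as in the tail bounds. Monotonicity transfers this to the rate of every round
  \<open>t \<ge> n\<close>, so all intervals are valid at all times up to \<open>T\<close>.\<close>

locale mlucb_concentrated = mlucb +
  fixes T :: nat
  assumes rate_nonneg: "\<And>n. 1 \<le> n \<Longrightarrow> 0 \<le> \<beta> n"
    and rate_mono: "\<And>n t. 1 \<le> n \<Longrightarrow> n \<le> t \<Longrightarrow> \<beta> n \<le> \<beta> t"
    and concentrated: "\<And>P n. P \<in> arms K Ks \<Longrightarrow> n \<in> {1..T} \<Longrightarrow>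
      \<bar>deviation y \<mu> P n\<bar> \<le> sqrt (real n * \<beta> n / 2)"
begin

definition radius :: "nat \<Rightarrow> nat \<Rightarrow> real" where
  "radius t n = sqrt (\<beta> t / (2 * real n))"

lemma scaled_radius:
  assumes "0 < n"
  shows "sqrt (real n * b / 2) / real n = sqrt (b / (2 * real n))"
proof -
  have "sqrt (real n * b / 2) / real n = sqrt (real n * b / 2) / sqrt ((real n)\<^sup>2)"
    by simp
  also have "\<dots> = sqrt (real n * b / 2 / (real n)\<^sup>2)"
    by (rule real_sqrt_divide[symmetric])
  also have "real n * b / 2 / (real n)\<^sup>2 = b / (2 * real n)"
    using assms by (simp add: power2_eq_square)
  finally show ?thesis .
qed

lemma emp_mean_close:
  assumes "t \<le> T" "P \<in> arms K Ks" "0 < num_draws (hist t) P"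
  shows "\<bar>emp_mean m0 (hist t) P - \<mu> P\<bar> \<le> radius t (num_draws (hist t) P)"
proof -
  let ?n = "num_draws (hist t) P"
  have n: "1 \<le> ?n" "?n \<le> t"
    using assms(3) num_draws_le_length[of "hist t" P] by auto
  have "\<bar>emp_mean m0 (hist t) P - \<mu> P\<bar> = \<bar>deviation y \<mu> P ?n\<bar> / real ?n"
    using assms(3) by (simp add: emp_mean_play[where \<mu> = \<mu>])
  also have "\<dots> \<le> sqrt (real ?n * \<beta> ?n / 2) / real ?n"
    using n assms by (intro divide_right_mono concentrated) auto
  also have "\<dots> = sqrt (\<beta> ?n / (2 * real ?n))"
    using assms(3) by (rule scaled_radius)
  also have "\<dots> \<le> radius t ?n"
    unfolding radius_def using n by (intro real_sqrt_le_mono divide_right_mono rate_mono) auto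
  finally show ?thesis .
qed

lemma lcb_hist: "0 < num_draws (hist t) P \<Longrightarrow>
    lcb \<beta> m0 (hist t) P = ereal (emp_mean m0 (hist t) P - radius t (num_draws (hist t) P))"
  and ucb_hist: "0 < num_draws (hist t) P \<Longrightarrow>
    ucb \<beta> m0 (hist t) P = ereal (emp_mean m0 (hist t) P + radius t (num_draws (hist t) P))"
  by (simp_all add: lcb_def ucb_def radius_def)

lemma lcb_undrawn: "num_draws h P = 0 \<Longrightarrow> lcb \<beta> m0 h P = - \<infinity>"
  and ucb_undrawn: "num_draws h P = 0 \<Longrightarrow> ucb \<beta> m0 h P = \<infinity>"
  by (simp_all add: lcb_def ucb_def)

lemma lcb_le_mean:
  assumes "t \<le> T" "P \<in> arms K Ks"
  shows "lcb \<beta> m0 (hist t) P \<le> ereal (\<mu> P)"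
proof (cases "num_draws (hist t) P = 0")
  case False
  with emp_mean_close[OF assms] show ?thesis
    by (simp add: lcb_hist abs_le_iff)
qed (simp add: lcb_undrawn)

lemma mean_le_ucb:
  assumes "t \<le> T" "P \<in> arms K Ks"
  shows "ereal (\<mu> P) \<le> ucb \<beta> m0 (hist t) P"
proof (cases "num_draws (hist t) P = 0")
  case False
  with emp_mean_close[OF assms] show ?thesis
    by (simp add: ucb_hist abs_le_iff)
qed (simp add: ucb_undrawn)

lemma radius_nonneg:
  assumes "0 < num_draws (hist t) P"
  shows "0 \<le> radius t (num_draws (hist t) P)"
proof -
  have "1 \<le> t"
    using assms num_draws_le_length[of "hist t" P] by simp
  then show ?thesis
    by (simp add: radius_def rate_nonneg)
qed

text \<open>The empirical mean of an undrawn arm is arbitrary, but its bounds are infinite. Hence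
  the recommendation can be compared with the bounds for all arms.\<close>

lemma lcb_le_emp_mean: "lcb \<beta> m0 (hist t) P \<le> ereal (emp_mean m0 (hist t) P)"
proof (cases "num_draws (hist t) P = 0")
  case False
  with radius_nonneg[of t P] show ?thesis
    by (simp add: lcb_hist)
qed (simp add: lcb_undrawn)

lemma emp_mean_le_ucb: "ereal (emp_mean m0 (hist t) P) \<le> ucb \<beta> m0 (hist t) P"
proof (cases "num_draws (hist t) P = 0")
  case False
  with radius_nonneg[of t P] show ?thesis
    by (simp add: ucb_hist)
qed (simp add: ucb_undrawn)

text \<open>If an action other than 1 were separated from the rest, its value would exceed some mean
  of action 1. Empirical means lie between their bounds, so they inherit the separation and the
  recommendation is 1 too.\<close>

lemma stops_correct:
  assumes "even t" "t \<le> T" "mlucb_stops K Ks \<beta> m0 (hist t)"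
  shows "ih (hist t) = 1"
proof -
  obtain i where i: "i \<in> {1..K}"
    and sep: "\<And>i'. i' \<in> {1..K} - {i} \<Longrightarrow>
      \<exists>j'\<in>{1..Ks i'}. \<forall>j\<in>{1..Ks i}. ucb \<beta> m0 (hist t) (i', j') < lcb \<beta> m0 (hist t) (i, j)"
    using stops_separated[OF assms(3)] by metis
  have "i = 1"
  proof (rule ccontr)
    assume "i \<noteq> 1"
    then obtain j' where j': "j' \<in> {1..Ks 1}"
      "ucb \<beta> m0 (hist t) (1, j') < lcb \<beta> m0 (hist t) (i, 1)"
      using sep[of 1] one_in Ks_ge_1[OF i] by fastforce
    have "(1, j') \<in> arms K Ks"
      using j'(1) one_in by (simp add: arms_iff)
    have "ereal (\<mu> (1, j')) \<le> ucb \<beta> m0 (hist t) (1, j')"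
      by (rule mean_le_ucb) fact+
    also note j'(2)
    also have "lcb \<beta> m0 (hist t) (i, 1) \<le> ereal (\<mu> (i, 1))"
      by (rule lcb_le_mean[OF \<open>t \<le> T\<close> first_arm[OF i]])
    finally have "\<mu> (1, j') < \<mu> (i, 1)"
      by simp
    with first_le[OF \<open>(1, j') \<in> arms K Ks\<close>] other_less_mid[OF i \<open>i \<noteq> 1\<close>] mid_less show False
      by linarith
  qed
  show ?thesis
  proof (rule ccontr)
    let ?i = "ih (hist t)"
    have even: "even (length (hist t))"
      using \<open>even t\<close> by simp
    assume "?i \<noteq> 1"
    then obtain j' where j': "j' \<in> {1..Ks ?i}"
      "\<And>j. j \<in> {1..Ks 1} \<Longrightarrow> ucb \<beta> m0 (hist t) (?i, j') < lcb \<beta> m0 (hist t) (1, j)"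
      using sep[of ?i] ih_in[OF even] \<open>i = 1\<close> by blast
    have "emp_mean m0 (hist t) (?i, j') < emp_mean m0 (hist t) (1, j)" if "j \<in> {1..Ks 1}" for j
    proof -
      have "ereal (emp_mean m0 (hist t) (?i, j')) < ereal (emp_mean m0 (hist t) (1, j))"
        using emp_mean_le_ucb j'(2)[OF that] lcb_le_emp_mean by (rule le_less_trans[OF _ less_le_trans])
      then show ?thesis
        by simp
    qed
    then have "emp_mean m0 (hist t) (?i, j') < (MIN j\<in>{1..Ks 1}. emp_mean m0 (hist t) (1, j))"
      using Ks_ge_1[OF one_in] by (subst Min_gr_iff) auto
    also have "\<dots> \<le> (MIN j\<in>{1..Ks ?i}. emp_mean m0 (hist t) (?i, j))"
      by (rule ih_max[OF even one_in])
    also have "\<dots> \<le> emp_mean m0 (hist t) (?i, j')"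
      using j'(1) by (intro Min_le) auto
    finally show False
      by simp
  qed
qed

text \<open>If both intervals miss the midpoint, each lies above or below it. All four combinations
  contradict a choice rule, the absence of stopping or the validity of the intervals.\<close>

lemma drawn_arm_confused:
  assumes "even t" "t \<le> T" "\<not> mlucb_stops K Ks \<beta> m0 (hist t)"
  obtains i where "i \<in> {1..K}"
    "(i, cc (hist t) i) = (ih (hist t), cc (hist t) (ih (hist t))) \<or> (i, cc (hist t) i) = S (hist t)"
    "lcb \<beta> m0 (hist t) (i, cc (hist t) i) \<le> ereal mid"
    "ereal mid \<le> ucb \<beta> m0 (hist t) (i, cc (hist t) i)"
proof -
  let ?h = "hist t"
  let ?L = "lcb \<beta> m0 ?h" and ?U = "ucb \<beta> m0 ?h"
  define r where "r = ih ?h"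
  have even: "even (length ?h)"
    using \<open>even t\<close> by simp
  obtain s where s: "s \<in> {1..K}" "s \<noteq> r" "S ?h = (s, cc ?h s)"
    using S_eq[OF even] unfolding r_def by blast
  have r: "r \<in> {1..K}"
    unfolding r_def by (rule ih_in[OF even])
  have overlap: "?L (r, cc ?h r) \<le> ?U (s, cc ?h s)"
    using not_stops_overlap[OF even assms(3)] s(3) by (simp add: r_def)
  have above: "i = 1" if "i \<in> {1..K}" "ereal mid < ?L (i, cc ?h i)" for i
  proof (rule ccontr)
    assume "i \<noteq> 1"
    have "?L (i, cc ?h i) \<le> ?L (i, 1)"
      by (rule lcb_cc_le[OF even first_arm[OF that(1)]])
    also have "\<dots> \<le> ereal (\<mu> (i, 1))"
      by (rule lcb_le_mean[OF \<open>t \<le> T\<close> first_arm[OF that(1)]])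
    finally have "ereal mid < ereal (\<mu> (i, 1))"
      using that(2) by (rule less_le_trans[rotated])
    then show False
      using other_less_mid[OF that(1) \<open>i \<noteq> 1\<close>] by simp
  qed
  have action_1: "ereal mid < ?U (1, cc ?h 1)"
  proof -
    have a: "(1, cc ?h 1) \<in> arms K Ks"
      by (rule cc_arms[OF even one_in])
    have "mid < \<mu> (1, cc ?h 1)"
      using mid_less first_le[OF a] by linarith
    then have "ereal mid < ereal (\<mu> (1, cc ?h 1))"
      by simp
    also have "\<dots> \<le> ?U (1, cc ?h 1)"
      by (rule mean_le_ucb[OF \<open>t \<le> T\<close> a])
    finally show ?thesis .
  qed
  have "(?L (r, cc ?h r) \<le> ereal mid \<and> ereal mid \<le> ?U (r, cc ?h r)) \<or>
    (?L (s, cc ?h s) \<le> ereal mid \<and> ereal mid \<le> ?U (s, cc ?h s))"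
  proof (rule ccontr)
    assume "\<not> ?thesis"
    then have "(ereal mid < ?L (r, cc ?h r) \<or> ?U (r, cc ?h r) < ereal mid) \<and>
        (ereal mid < ?L (s, cc ?h s) \<or> ?U (s, cc ?h s) < ereal mid)"
      by (simp only: de_Morgan_disj de_Morgan_conj not_le)
    then consider
        (both_above) "ereal mid < ?L (r, cc ?h r)" "ereal mid < ?L (s, cc ?h s)"
      | (both_below) "?U (r, cc ?h r) < ereal mid" "?U (s, cc ?h s) < ereal mid"
      | (r_above) "ereal mid < ?L (r, cc ?h r)" "?U (s, cc ?h s) < ereal mid"
      | (s_above) "?U (r, cc ?h r) < ereal mid" "ereal mid < ?L (s, cc ?h s)"
      by blast
    then show False
    proof cases
      \<comment> \<open>Only action 1 can have its representative's interval above the midpoint, and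
        \<open>r\<close> and \<open>s\<close> differ.\<close>
      case both_above
      then show False
        using above r s by metis
    next
      case both_below
      show False
      \<comment> \<open>If action 1 is not the leader, it competes for the challenger, whose upper
        bound is then above the midpoint as well.\<close>
      proof (cases "r = 1")
        case True
        with both_below action_1 show False
          by simp
      next
        case False
        then have "?U (1, cc ?h 1) \<le> ?U (s, cc ?h s)"
          using S_max[OF even, of 1] one_in s(3) by (simp add: r_def)
        with both_below action_1 show False
          by (meson less_trans not_less)
      qed
    next
      case r_above
      with overlap show False
        by (meson less_trans not_less)
    next
      \<comment> \<open>Here the empirical minimum of \<open>s\<close> exceeds that of
        \<open>r\<close>, against the choice of \<open>ih\<close>.\<close>
      case s_above
      have "(MIN j\<in>{1..Ks r}. emp_mean m0 ?h (r, j)) \<le> emp_mean m0 ?h (r, cc ?h r)"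
        using cc_arms[OF even r] by (intro Min_le) (auto simp: arms_iff)
      moreover have "emp_mean m0 ?h (r, cc ?h r) < mid"
        using le_less_trans[OF emp_mean_le_ucb s_above(1)] by simp
      moreover have "mid < emp_mean m0 ?h (s, j)" if "j \<in> {1..Ks s}" for j
      proof -
        have "(s, j) \<in> arms K Ks"
          using that s(1) by (simp add: arms_iff)
        note s_above(2)
        also have "?L (s, cc ?h s) \<le> ?L (s, j)"
          by (rule lcb_cc_le[OF even \<open>(s, j) \<in> arms K Ks\<close>])
        also have "\<dots> \<le> ereal (emp_mean m0 ?h (s, j))"
          by (rule lcb_le_emp_mean)
        finally show ?thesis
          by simp
      qed
      then have "mid < (MIN j\<in>{1..Ks s}. emp_mean m0 ?h (s, j))"
        using Ks_ge_1[OF s(1)] by (subst Min_gr_iff) auto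
      moreover have "(MIN j\<in>{1..Ks s}. emp_mean m0 ?h (s, j)) \<le> (MIN j\<in>{1..Ks r}. emp_mean m0 ?h (r, j))"
        unfolding r_def by (rule ih_max[OF even s(1)])
      ultimately show False
        by linarith
    qed
  qed
  then show thesis
  proof (elim disjE conjE)
    assume "?L (r, cc ?h r) \<le> ereal mid" "ereal mid \<le> ?U (r, cc ?h r)"
    then show thesis
      by (intro that[OF r disjI1]) (simp_all add: r_def)
  next
    assume "?L (s, cc ?h s) \<le> ereal mid" "ereal mid \<le> ?U (s, cc ?h s)"
    then show thesis
      by (intro that[OF s(1) disjI2]) (simp_all add: s(3))
  qed
qed

section \<open>Sample sizes of arms whose interval contains the midpoint, and the stopping
  time\<close>

lemma radius_sq: "1 \<le> t \<Longrightarrow> (radius t n)\<^sup>2 = \<beta> t / (2 * real n)"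
  by (simp add: radius_def rate_nonneg)

lemma draws_le_of_radius:
  assumes "1 \<le> t" "0 < n" "0 \<le> g" "g \<le> (k * radius t n)\<^sup>2"
  shows "real n * g \<le> k\<^sup>2 / 2 * \<beta> t"
  using assms by (simp add: power_mult_distrib radius_sq field_simps)

text \<open>The interval, of length two radii, contains the midpoint, \<open>\<mu> P\<close> and
  also \<open>\<mu> (i, 1)\<close>: its lower end is below the latter because \<open>cc\<close>
  minimises the lower bound, and \<open>\<mu> (i, 1) \<le> \<mu> P\<close>. So both distances in
  \<open>gap P\<close> are at most two radii.\<close>

lemma draws_of_confused_arm:
  assumes "even t" "t \<le> T" "i \<in> {1..K}"
    and P: "P = (i, cc (hist t) i)" and drawn: "0 < num_draws (hist t) P"
    and low: "lcb \<beta> m0 (hist t) P \<le> ereal mid" and up: "ereal mid \<le> ucb \<beta> m0 (hist t) P"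
  shows "real (num_draws (hist t) P) * gap P \<le> 2 * \<beta> t"
proof -
  define n where "n = num_draws (hist t) P"
  define r where "r = radius t n"
  define e where "e = emp_mean m0 (hist t) P"
  have "1 \<le> t"
    using drawn num_draws_le_length[of "hist t" P] by simp
  have even: "even (length (hist t))"
    using \<open>even t\<close> by simp
  have arm: "P \<in> arms K Ks"
    unfolding P by (rule cc_arms[OF even \<open>i \<in> {1..K}\<close>])
  have bounds: "lcb \<beta> m0 (hist t) P = ereal (e - r)" "ucb \<beta> m0 (hist t) P = ereal (e + r)"
    using drawn by (simp_all add: lcb_hist ucb_hist e_def r_def n_def)
  have "lcb \<beta> m0 (hist t) P \<le> lcb \<beta> m0 (hist t) (i, 1)"
    unfolding P by (rule lcb_cc_le[OF even first_arm[OF \<open>i \<in> {1..K}\<close>]])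
  also have "\<dots> \<le> ereal (\<mu> (i, 1))"
    by (rule lcb_le_mean[OF \<open>t \<le> T\<close> first_arm[OF \<open>i \<in> {1..K}\<close>]])
  finally have 1: "e - r \<le> \<mu> (i, 1)"
    by (simp add: bounds)
  have 2: "\<mu> (i, 1) \<le> \<mu> P"
    using first_le arm unfolding P by blast
  have 3: "\<mu> P \<le> e + r"
    using mean_le_ucb[OF \<open>t \<le> T\<close> arm] by (simp add: bounds)
  have 4: "e - r \<le> mid" "mid \<le> e + r"
    using low up by (simp_all add: bounds)
  have "\<bar>\<mu> (i, 1) - mid\<bar> \<le> \<bar>2 * r\<bar>" "\<bar>\<mu> P - \<mu> (i, 1)\<bar> \<le> \<bar>2 * r\<bar>"
    using 1 2 3 4 by linarith+
  then have "gap P \<le> (2 * r)\<^sup>2"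
    unfolding gap_def P by (simp add: abs_le_square_iff)
  then have "real n * gap P \<le> 2\<^sup>2 / 2 * \<beta> t"
    unfolding r_def using \<open>1 \<le> t\<close> drawn gap_pos[OF arm]
    by (intro draws_le_of_radius) (auto simp: n_def)
  then show ?thesis
    by (simp add: n_def)
qed

text \<open>A deviation towards the midpoint of at most \<open>3 / 4\<close> radius leaves a
  distance of at most \<open>7 / 4\<close> radii instead of 2, and
  \<open>(7 / 4)\<^sup>2 / 2 = 49 / 32\<close>. Towards the midpoint means downwards for
  \<open>(1, 1)\<close> and upwards for \<open>(2, 1)\<close>.\<close>

lemma draws_of_typical_arm:
  fixes P :: arm
  assumes "t \<le> T" and drawn: "0 < num_draws (hist t) P"
    and low: "lcb \<beta> m0 (hist t) P \<le> ereal mid" and up: "ereal mid \<le> ucb \<beta> m0 (hist t) P"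
    and typical: "P = (1, 1) \<and> (\<forall>n\<in>{1..T}. - deviation y \<mu> (1, 1) n \<le> 3 / 4 * sqrt (real n * l / 2)) \<or>
      P = (2, 1) \<and> (\<forall>n\<in>{1..T}. deviation y \<mu> (2, 1) n \<le> 3 / 4 * sqrt (real n * l / 2))"
    and l: "\<And>n. 1 \<le> n \<Longrightarrow> l \<le> \<beta> n"
  shows "real (num_draws (hist t) P) * gap P \<le> 49 / 32 * \<beta> t"
proof -
  define n where "n = num_draws (hist t) P"
  define r where "r = radius t n"
  define d where "d = deviation y \<mu> P n / real n"
  have n: "1 \<le> n" "n \<le> t"
    using drawn num_draws_le_length[of "hist t" P] by (simp_all add: n_def)
  have "3 / 4 * sqrt (real n * l / 2) / real n = 3 / 4 * (sqrt (real n * l / 2) / real n)"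
    by simp
  also have "sqrt (real n * l / 2) / real n = sqrt (l / (2 * real n))"
    using n by (intro scaled_radius) auto
  also have "\<dots> \<le> r"
    unfolding r_def radius_def using n l[of t]
    by (intro real_sqrt_le_mono divide_right_mono) auto
  finally have small: "3 / 4 * sqrt (real n * l / 2) / real n \<le> 3 / 4 * r"
    by simp
  have "n \<in> {1..T}"
    using n \<open>t \<le> T\<close> by simp
  have "emp_mean m0 (hist t) P = \<mu> P + d"
    using drawn by (simp add: emp_mean_play[where \<mu> = \<mu>] d_def n_def)
  then have 1: "\<mu> P + d - r \<le> mid" "mid \<le> \<mu> P + d + r"
    using low up drawn by (simp_all add: lcb_hist ucb_hist r_def n_def)
  from typical have "\<mu> (1, 1) - mid \<le> 7 / 4 * r \<and> gap P = (\<mu> (1, 1) - mid)\<^sup>2"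
  proof (elim disjE conjE)
    assume P: "P = (1, 1)"
      and dev: "\<forall>n\<in>{1..T}. - deviation y \<mu> (1, 1) n \<le> 3 / 4 * sqrt (real n * l / 2)"
    have "- d \<le> 3 / 4 * sqrt (real n * l / 2) / real n"
      using dev \<open>n \<in> {1..T}\<close> n unfolding d_def P
      by (simp only: minus_divide_left) (intro divide_right_mono, auto)
    with 1 small P show ?thesis
      by (simp add: gap_first_arms[simplified])
  next
    assume P: "P = (2, 1)"
      and dev: "\<forall>n\<in>{1..T}. deviation y \<mu> (2, 1) n \<le> 3 / 4 * sqrt (real n * l / 2)"
    have "d \<le> 3 / 4 * sqrt (real n * l / 2) / real n"
      using dev \<open>n \<in> {1..T}\<close> n unfolding d_def P
      by (intro divide_right_mono) auto
    then have "mid - \<mu> (2, 1) \<le> 7 / 4 * r"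
      using 1(2) small P by simp
    moreover have "mid - \<mu> (2, 1) = \<mu> (1, 1) - mid"
      by (simp add: mid_def field_simps)
    ultimately show ?thesis
      using P by (simp add: gap_first_arms[simplified])
  qed
  then have "gap P \<le> (7 / 4 * r)\<^sup>2"
    using mid_less by (simp add: power_mono)
  then have "real n * gap P \<le> (7 / 4)\<^sup>2 / 2 * \<beta> t"
    unfolding r_def using n typical gap_pos first_arms
    by (intro draws_le_of_radius) (auto simp: less_imp_le)
  then show ?thesis
    by (simp add: n_def power2_eq_square)
qed

text \<open>Each pair of rounds before stopping is charged to an arm drawn in it whose interval
  contains the midpoint. The sample-size bounds limit the charges of every arm, and their total is
  less than \<open>m\<close>.\<close>

lemma stops_early:
  assumes typical: "(\<forall>n\<in>{1..T}. - deviation y \<mu> (1, 1) n \<le> 3 / 4 * sqrt (real n * l / 2)) \<or>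
      (\<forall>n\<in>{1..T}. deviation y \<mu> (2, 1) n \<le> 3 / 4 * sqrt (real n * l / 2))"
    and l: "\<And>n. 1 \<le> n \<Longrightarrow> l \<le> \<beta> n"
    and m: "2 * m \<le> T" "0 < m"
    and large: "(2 * H_star K Ks \<mu> - 1) * \<beta> (2 * m) + real (card (arms K Ks)) < real m"
  shows "\<exists>k<m. mlucb_stops K Ks \<beta> m0 (hist (2 * k))"
proof (rule ccontr)
  assume "\<not> ?thesis"
  then have running: "\<not> mlucb_stops K Ks \<beta> m0 (hist (2 * k))" if "k < m" for k
    using that by blast
  define b where "b = \<beta> (2 * m)"
  have "0 \<le> b"
    unfolding b_def using m by (intro rate_nonneg) auto
  obtain Q :: arm where Q: "Q = (1, 1) \<or> Q = (2, 1)"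
    and typical_Q: "Q = (1, 1) \<and> (\<forall>n\<in>{1..T}. - deviation y \<mu> (1, 1) n \<le> 3 / 4 * sqrt (real n * l / 2)) \<or>
      Q = (2, 1) \<and> (\<forall>n\<in>{1..T}. deviation y \<mu> (2, 1) n \<le> 3 / 4 * sqrt (real n * l / 2))"
    using typical by blast
  have Q_arm: "Q \<in> arms K Ks"
    using Q first_arms by blast
  \<comment> \<open>\<open>w P * b\<close> bounds the number of earlier draws of \<open>P\<close>
    whenever \<open>P\<close> is charged.\<close>
  define w where "w P = (if P = Q then 49 / 32 else 2) / gap P" for P
  have w_nonneg: "0 \<le> w P" if "P \<in> arms K Ks" for P
    using gap_pos[OF that] by (simp add: w_def)
  have "\<exists>P\<in>arms K Ks.
      (P = (ih (hist (2 * k)), cc (hist (2 * k)) (ih (hist (2 * k)))) \<or> P = S (hist (2 * k))) \<and>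
      real (num_draws (hist (2 * k)) P) \<le> w P * b" if k: "k < m" for k
  proof -
    have t: "even (2 * k)" "2 * k \<le> T"
      using k m by auto
    obtain i where i: "i \<in> {1..K}"
      "(i, cc (hist (2 * k)) i) = (ih (hist (2 * k)), cc (hist (2 * k)) (ih (hist (2 * k)))) \<or>
        (i, cc (hist (2 * k)) i) = S (hist (2 * k))"
      "lcb \<beta> m0 (hist (2 * k)) (i, cc (hist (2 * k)) i) \<le> ereal mid"
      "ereal mid \<le> ucb \<beta> m0 (hist (2 * k)) (i, cc (hist (2 * k)) i)"
      by (rule drawn_arm_confused[OF t running[OF k]])
    define P where "P = (i, cc (hist (2 * k)) i)"
    have arm: "P \<in> arms K Ks"
      unfolding P_def using i(1) by (intro cc_arms) auto
    have "real (num_draws (hist (2 * k)) P) \<le> w P * b"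
    proof (cases "num_draws (hist (2 * k)) P = 0")
      case True
      then show ?thesis
        using w_nonneg[OF arm] \<open>0 \<le> b\<close> by simp
    next
      case False
      then have drawn: "0 < num_draws (hist (2 * k)) P"
        by simp
      then have "1 \<le> 2 * k"
        using num_draws_le_length[of "hist (2 * k)" P] by simp
      then have rate: "\<beta> (2 * k) \<le> b"
        unfolding b_def using k by (intro rate_mono) auto
      have "real (num_draws (hist (2 * k)) P) * gap P \<le> (if P = Q then 49 / 32 else 2) * \<beta> (2 * k)"
      proof (cases "P = Q")
        case True
        then show ?thesis
          using draws_of_typical_arm[OF t(2) drawn _ _ _ l] i(3,4) typical_Q
          by (simp add: P_def)
      next
        case False
        then show ?thesis
          using draws_of_confused_arm[OF t i(1) P_def drawn] i(3,4) by (simp add: P_def)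
      qed
      also have "\<dots> \<le> (if P = Q then 49 / 32 else 2) * b"
        using rate by (intro mult_left_mono) auto
      finally show ?thesis
        using gap_pos[OF arm] by (simp add: w_def pos_le_divide_eq)
    qed
    with arm i(2) show ?thesis
      unfolding P_def by blast
  qed
  then obtain f where f: "\<And>k. k < m \<Longrightarrow> f k \<in> arms K Ks"
    "\<And>k. k < m \<Longrightarrow> f k = (ih (hist (2 * k)), cc (hist (2 * k)) (ih (hist (2 * k)))) \<or>
      f k = S (hist (2 * k))"
    "\<And>k. k < m \<Longrightarrow> real (num_draws (hist (2 * k)) (f k)) \<le> w (f k) * b"
    by metis
  \<comment> \<open>Every charge draws \<open>P\<close> again, so the counts at the charged times
    are distinct integers from 0 to \<open>w P * b\<close>. The count 0 accounts for the
    \<open>+ 1\<close>.\<close>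
  have fiber: "real (card {k \<in> {..<m}. f k = P}) \<le> w P * b + 1" if P: "P \<in> arms K Ks" for P
  proof -
    let ?F = "{k \<in> {..<m}. f k = P}"
    let ?N = "\<lambda>k. num_draws (hist (2 * k)) P"
    have less: "?N k < ?N k'" if "k \<in> ?F" "k < k'" for k k'
    proof -
      have "?N k < ?N (Suc k)"
        using f(2)[of k] that(1) by (subst hist_double_Suc) auto
      also have "\<dots> \<le> ?N k'"
        using that(2) by (intro num_draws_play_mono) auto
      finally show ?thesis .
    qed
    have "inj_on ?N ?F"
      by (rule linorder_inj_onI) (use less in \<open>fastforce+\<close>)
    moreover have "?N ` ?F \<subseteq> {..nat \<lfloor>w P * b\<rfloor>}"
      using f(3) by (auto intro: le_nat_floor)
    ultimately have "card ?F \<le> card {..nat \<lfloor>w P * b\<rfloor>}"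
      by (intro card_inj_on_le) auto
    moreover have "0 \<le> w P * b"
      using w_nonneg[OF P] \<open>0 \<le> b\<close> by simp
    ultimately show ?thesis
      by simp linarith
  qed
  have "real m = (\<Sum>k<m. 1)"
    by simp
  also have "\<dots> = (\<Sum>P\<in>arms K Ks. \<Sum>k | k \<in> {..<m} \<and> f k = P. 1)"
    by (rule sum.group[symmetric]) (use f(1) finite_arms in auto)
  also have "\<dots> = (\<Sum>P\<in>arms K Ks. real (card {k \<in> {..<m}. f k = P}))"
    by simp
  also have "\<dots> \<le> (\<Sum>P\<in>arms K Ks. w P * b + 1)"
    by (intro sum_mono fiber)
  also have "\<dots> = b * (\<Sum>P\<in>arms K Ks. w P) + real (card (arms K Ks))"
    by (simp add: sum.distrib sum_distrib_left mult.commute)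
  \<comment> \<open>The numerator saved at \<open>Q\<close> is
    \<open>2 - 49 / 32 = 15 / 32\<close>.\<close>
  also have "(\<Sum>P\<in>arms K Ks. w P) = (\<Sum>P\<in>arms K Ks. 2 * (1 / gap P) - (if P = Q then 15 / 32 / gap P else 0))"
    by (intro sum.cong) (auto simp: w_def field_simps)
  also have "\<dots> = 2 * H_star K Ks \<mu> - 15 / 32 / gap Q"
    using Q_arm finite_arms[of K Ks]
    by (simp add: sum_subtractf H_star_gap sum_distrib_left)
  \<comment> \<open>With a gap of at most \<open>1 / 4\<close> the saving is at least
    \<open>15 / 8\<close>, which is rounded down to 1.\<close>
  also have "b * (2 * H_star K Ks \<mu> - 15 / 32 / gap Q) \<le> b * (2 * H_star K Ks \<mu> - 1)"
  proof -
    have "gap Q \<le> 1 / 4"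
      using Q gap_first_arms_le by (auto simp: gap_first_arms[simplified])
    then have "1 \<le> 15 / 32 / gap Q"
      using gap_pos[OF Q_arm] by (simp add: pos_le_divide_eq)
    then show ?thesis
      using \<open>0 \<le> b\<close> by (intro mult_left_mono) auto
  qed
  finally show False
    using large by (simp add: b_def mult.commute)
qed

text \<open>Stopping at a pair index below \<open>m\<close> means a time of at most
  \<open>2 * (m - 1)\<close>; this \<open>- 1\<close> later compensates for rounding
  \<open>m\<close> up.\<close>

lemma mlucb_time_bound:
  assumes "k < m" "2 * m \<le> T" "mlucb_stops K Ks \<beta> m0 (hist (2 * k))"
  shows "\<exists>t. mlucb_time K Ks \<beta> m0 hist = enat t \<and> ih (hist t) = 1 \<and> t \<le> 2 * (m - 1)"
proof -
  let ?P = "\<lambda>t. even t \<and> mlucb_stops K Ks \<beta> m0 (hist t)"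
  have P: "?P (2 * k)"
    using assms by simp
  then obtain t where t: "?P t" "\<forall>s<t. \<not> ?P s"
    using exists_least_iff[of ?P] by blast
  then have "t \<le> 2 * k"
    using P not_less by blast
  moreover have "mlucb_time K Ks \<beta> m0 hist = enat t"
    using t unfolding mlucb_time_eq_enat_iff by blast
  moreover have "ih (hist t) = 1"
    using t \<open>t \<le> 2 * k\<close> assms by (intro stops_correct) auto
  ultimately show ?thesis
    using assms(1) by (intro exI[of _ t]) auto
qed

end


section \<open>Measurability of the successful event\<close>

locale mlucb_sampling = maximin_game K Ks \<mu> for K Ks \<mu> +
  fixes \<beta> m0 and M :: "'w measure" and Y and R :: "'r measure" and \<xi> ih cc S
  assumes model: "mlucb_model K Ks \<mu> \<beta> m0 M Y R \<xi> ih cc S"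
begin

lemma mlucb_run:
  assumes "\<omega> \<in> space M"
  shows "mlucb K Ks \<mu> \<beta> m0 (ih (\<xi> \<omega>)) (cc (\<xi> \<omega>)) (S (\<xi> \<omega>))"
proof
  have "\<xi> \<omega> \<in> space R"
    using model assms by (auto simp: mlucb_model_def measurable_def)
  then show "mlucb_choices K Ks \<beta> m0 (ih (\<xi> \<omega>)) (cc (\<xi> \<omega>)) (S (\<xi> \<omega>))"
    using model by (simp add: mlucb_model_def)
qed

lemma measurable_seed_choices:
  "(\<lambda>\<omega>. ih (\<xi> \<omega>) h) \<in> measurable M (count_space UNIV)"
  "(\<lambda>\<omega>. cc (\<xi> \<omega>) h i) \<in> measurable M (count_space UNIV)"
  "(\<lambda>\<omega>. S (\<xi> \<omega>) h) \<in> measurable M (count_space UNIV)"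
  using model by (auto simp: mlucb_model_def intro: measurable_compose[of \<xi> M R])

lemma measurable_next:
  "(\<lambda>\<omega>. mlucb_next (ih (\<xi> \<omega>)) (cc (\<xi> \<omega>)) (S (\<xi> \<omega>)) h) \<in> measurable M (count_space UNIV)"
proof (cases "even (length h)")
  case True
  have "(\<lambda>\<omega>. (\<lambda>i \<omega>. (i, cc (\<xi> \<omega>) h i)) (ih (\<xi> \<omega>) h) \<omega>) \<in> measurable M (count_space UNIV)"
    by (rule measurable_compose_countable[OF _ measurable_seed_choices(1)])
       (rule measurable_compose[OF measurable_seed_choices(2)], simp)
  with True show ?thesis
    by (simp add: mlucb_next_def)
qed (simp add: mlucb_next_def measurable_seed_choices)

lemma measurable_model_draw:
  "P \<in> arms K Ks \<Longrightarrow> Y P n \<in> measurable M (count_space UNIV)"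
  using model unfolding mlucb_model_def bernoulli_draws_def
  by (force simp: prob_space.indep_vars_def)

text \<open>Histories form a countable type, so maps that are measurable for each fixed history can
  be composed with the random history.\<close>

lemma measurable_history:
  "(\<lambda>\<omega>. mlucb_history Y \<xi> ih cc S \<omega> t) \<in> measurable M (count_space UNIV)"
proof (induction t)
  case (Suc t)
  \<comment> \<open>Measurability of \<open>Y P\<close> is known only for arms of the game, so the
    outcome is masked elsewhere. By \<open>next_arms\<close> the mask never takes effect in a
    run.\<close>
  define F where "F h P \<omega> = h @ [(P, P \<in> arms K Ks \<and> Y P (num_draws h P) \<omega>)]" for h :: history and P \<omega>
  have F: "F h P \<in> measurable M (count_space UNIV)" for h P
  proof (cases "P \<in> arms K Ks")
    case True
    have "(\<lambda>\<omega>. h @ [(P, Y P (num_draws h P) \<omega>)]) \<in> measurable M (count_space UNIV)"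
      by (rule measurable_compose[OF measurable_model_draw[OF True]]) simp
    with True show ?thesis
      by (simp add: F_def [abs_def])
  qed (simp add: F_def [abs_def])
  have "(\<lambda>\<omega>. F h (mlucb_next (ih (\<xi> \<omega>)) (cc (\<xi> \<omega>)) (S (\<xi> \<omega>)) h) \<omega>) \<in> measurable M (count_space UNIV)" for h
    by (rule measurable_compose_countable[OF F measurable_next])
  then have "(\<lambda>\<omega>. (\<lambda>h \<omega>. F h (mlucb_next (ih (\<xi> \<omega>)) (cc (\<xi> \<omega>)) (S (\<xi> \<omega>)) h) \<omega>)
      (mlucb_history Y \<xi> ih cc S \<omega> t) \<omega>) \<in> measurable M (count_space UNIV)"
    by (rule measurable_compose_countable[OF _ Suc])
  then show ?case
    by (rule measurable_cong[THEN iffD1, rotated])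
       (use mlucb.next_arms[OF mlucb_run] in \<open>simp add: mlucb_history_def F_def Let_def\<close>)
qed (simp add: mlucb_history_def)

text \<open>Needed to compare the measure of this set with that of a \<open>good_event\<close>
  inside it. Both the quantifier over \<open>t\<close> and the condition on earlier times are
  countable.\<close>

lemma sets_success:
  "{\<omega> \<in> space M. \<exists>t. mlucb_time K Ks \<beta> m0 (mlucb_history Y \<xi> ih cc S \<omega>) = enat t \<and>
      ih (\<xi> \<omega>) (mlucb_history Y \<xi> ih cc S \<omega> t) = 1 \<and> real t \<le> B} \<in> sets M"
proof -
  have stops: "Measurable.pred M (\<lambda>\<omega>. mlucb_stops K Ks \<beta> m0 (mlucb_history Y \<xi> ih cc S \<omega> t))" for t
    by (rule measurable_compose[OF measurable_history]) simp
  have "(\<lambda>\<omega>. (\<lambda>h \<omega>. ih (\<xi> \<omega>) h) (mlucb_history Y \<xi> ih cc S \<omega> t) \<omega>) \<in> measurable M (count_space UNIV)" for t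
    by (rule measurable_compose_countable[OF measurable_seed_choices(1) measurable_history])
  then have "Measurable.pred M (\<lambda>\<omega>. ih (\<xi> \<omega>) (mlucb_history Y \<xi> ih cc S \<omega> t) = 1)" for t
    by (rule measurable_compose) simp
  note [measurable] = stops this
  show ?thesis
    unfolding mlucb_time_eq_enat_iff by measurable
qed

end


section \<open>Small confidence levels\<close>

text \<open>Termwise comparison with Euler's series. The strict gap \<open>d\<close>, uniform in
  \<open>J\<close>, comes from the single term at 2.\<close>

lemma sum_powr_lt_zeta_2:
  fixes p :: real
  assumes "2 < p"
  obtains s where "s < pi\<^sup>2 / 6"
    "\<And>J :: nat set. finite J \<Longrightarrow> 0 \<notin> J \<Longrightarrow> (\<Sum>k\<in>J. real k powr - p) \<le> s"
proof -
  define d :: real where "d = 1 / 4 - 2 powr - p"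
  have "(2 :: real) powr - p < 2 powr - 2"
    using assms by (intro powr_less_mono) auto
  also have "\<dots> = (1 / 4 :: real)"
    by (simp add: powr_minus)
  finally have "0 < d"
    by (simp add: d_def)
  have le: "real k powr - p \<le> 1 / (real k)\<^sup>2" if "k \<noteq> 0" for k :: nat
  proof -
    have "real k powr - p \<le> real k powr - 2"
      using assms that by (intro powr_mono) auto
    then show ?thesis
      using that by (simp add: powr_minus divide_inverse)
  qed
  have "(\<Sum>k\<in>J. real k powr - p) \<le> pi\<^sup>2 / 6 - d" if J: "finite J" "0 \<notin> J" for J :: "nat set"
  proof -
    \<comment> \<open>Inserting 2 makes the term with the gap available for every
      \<open>J\<close>.\<close>
    let ?I = "insert 2 J"
    define J' where "J' = (\<lambda>k. k - 1) ` ?I"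
    have I: "finite ?I" "0 \<notin> ?I" "2 \<in> ?I"
      using J by auto
    have "(\<Sum>k\<in>J. real k powr - p) \<le> (\<Sum>k\<in>?I. real k powr - p)"
      using J by (intro sum_mono2) auto
    also have "\<dots> = 2 powr - p + (\<Sum>k\<in>?I - {2}. real k powr - p)"
      using sum.remove[OF I(1,3), of "\<lambda>k. real k powr - p"] by simp
    also have "\<dots> \<le> 2 powr - p + (\<Sum>k\<in>?I - {2}. 1 / (real k)\<^sup>2)"
    proof -
      have "k \<noteq> 0" if "k \<in> ?I" for k
        using that I(2) by metis
      then show ?thesis
        by (intro add_mono order_refl sum_mono le) simp
    qed
    also have "\<dots> = (\<Sum>k\<in>?I. 1 / (real k)\<^sup>2) - d"
      using sum.remove[OF I(1,3), of "\<lambda>k. 1 / (real k)\<^sup>2"] by (simp add: d_def)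
    \<comment> \<open>Euler's series is indexed from 0 with terms at \<open>n + 1\<close>, hence the
      shift.\<close>
    also have "(\<Sum>k\<in>?I. 1 / (real k)\<^sup>2) = (\<Sum>n\<in>J'. 1 / (real (n + 1))\<^sup>2)"
    proof -
      have "inj_on (\<lambda>k. k - 1) ?I"
        using I(2) by (intro inj_onI) (metis One_nat_def Suc_pred neq0_conv)
      moreover have "(real (k - 1 + 1))\<^sup>2 = (real k)\<^sup>2" if "k \<in> ?I" for k
        using that I(2) by (cases k) auto
      ultimately show ?thesis
        unfolding J'_def by (subst sum.reindex) (auto intro!: sum.cong simp del: of_nat_add)
    qed
    also have "\<dots> \<le> (\<Sum>n. 1 / (real (n + 1))\<^sup>2)"
      using inverse_squares_sums I(1) unfolding J'_def
      by (intro sum_le_suminf) (auto simp: sums_iff add.commute)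
    also have "\<dots> = pi\<^sup>2 / 6"
      using inverse_squares_sums by (simp add: sums_iff add.commute)
    finally show ?thesis
      by simp
  qed
  then show thesis
    using that[of "pi\<^sup>2 / 6 - d"] \<open>0 < d\<close> by simp
qed

section \<open>The failure probability in terms of the confidence level\<close>

lemma explor_rate_eq:
  "explor_rate b c \<delta> n = (ln (1 / \<delta>) + b * ln (ln (1 / \<delta>))) + c * ln (ln (exp 1 * real n))"
  by (simp add: explor_rate_def)

text \<open>Uses \<open>exp (- x) = \<delta> / ln (1 / \<delta>) powr b\<close> and
  \<open>8 powr (c / 2) = (2 * sqrt 2) powr c\<close>. In this form \<open>f_bc\<close> is visibly
  the two-sided tail bound with \<open>pi\<^sup>2 / 6\<close> in place of \<open>s\<close>.\<close>

lemma f_bc_mult_eq: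
  fixes b c \<delta> :: real
  assumes "0 < \<delta>" "1 \<le> ln (1 / \<delta>)" "0 \<le> b"
  defines "x \<equiv> ln (1 / \<delta>) + b * ln (ln (1 / \<delta>))"
  shows "f_bc K Ks b c \<delta> * \<delta> = real (card (arms K Ks)) *
    (sqrt (exp 1) * (pi\<^sup>2 / 3) * (sqrt x / (2 * sqrt 2) + 1) powr c * exp (- x))"
proof -
  define L where "L = ln (1 / \<delta>)"
  have "1 \<le> L"
    using assms by (simp add: L_def)
  then have "0 \<le> x"
    using \<open>0 \<le> b\<close> unfolding x_def L_def[symmetric] by (intro add_nonneg_nonneg mult_nonneg_nonneg) auto
  have "exp (- x) = exp (- L) * exp (- (b * ln L))"
    unfolding x_def L_def by (simp flip: exp_add)
  also have "exp (- L) = \<delta>"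
    using \<open>0 < \<delta>\<close> by (simp add: L_def ln_div)
  also have "exp (- (b * ln L)) = 1 / L powr b"
    using \<open>1 \<le> L\<close> by (simp add: powr_def exp_minus field_simps)
  finally have exp_x: "exp (- x) = \<delta> / L powr b"
    by simp
  have "(8 :: real) powr (c / 2) = (8 powr (1 / 2)) powr c"
    by (simp add: powr_powr)
  also have "(8 :: real) powr (1 / 2) = sqrt 8"
    by (rule powr_half_sqrt) simp
  also have "sqrt 8 = 2 * sqrt 2"
    using real_sqrt_mult[of 4 2] by simp
  finally have "(sqrt x + 2 * sqrt 2) powr c * (1 / 8 powr (c / 2)) = ((sqrt x + 2 * sqrt 2) / (2 * sqrt 2)) powr c"
    using \<open>0 \<le> x\<close> by (simp add: powr_divide)
  also have "(sqrt x + 2 * sqrt 2) / (2 * sqrt 2) = sqrt x / (2 * sqrt 2) + 1"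
    by (simp add: add_divide_distrib)
  finally have powr: "(sqrt x / (2 * sqrt 2) + 1) powr c = (sqrt x + 2 * sqrt 2) powr c * (1 / 8 powr (c / 2))"
    by simp
  show ?thesis
    unfolding powr exp_x unfolding f_bc_def card_arms x_def L_def by (simp add: mult_ac)
qed

context mlucb_sampling
begin

text \<open>On the \<open>good_event\<close> with horizon \<open>2 * m\<close> every run meets the
  pathwise hypotheses, so failure is at most as likely as the complement of that event.\<close>

lemma success_probability:
  fixes b c \<delta> s :: real and m :: nat
  defines "L \<equiv> ln (1 / \<delta>)"
  defines "x \<equiv> L + b * ln L"
  assumes \<beta>: "\<beta> = explor_rate b c \<delta>"
    and "0 < \<delta>" "8 \<le> L" "0 \<le> b" "0 \<le> c"
    and s: "\<And>J :: nat set. finite J \<Longrightarrow> 0 \<notin> J \<Longrightarrow>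
      (\<Sum>k\<in>J. real k powr - (c * (1 - 1 / (2 * x)))) \<le> s"
    and m: "0 < m" "(2 * H_star K Ks \<mu> - 1) * \<beta> (2 * m) + real (card (arms K Ks)) < real m"
      "real (2 * (m - 1)) \<le> B"
  shows "1 - (real (card (arms K Ks)) * (2 * (sqrt (exp 1) * s * (sqrt x / (2 * sqrt 2) + 1) powr c * exp (- x))) +
      (real (2 * m))\<^sup>2 * exp (- (9 / 8 * L)))
    \<le> measure M {\<omega> \<in> space M. \<exists>t. mlucb_time K Ks \<beta> m0 (mlucb_history Y \<xi> ih cc S \<omega>) = enat t \<and>
      ih (\<xi> \<omega>) (mlucb_history Y \<xi> ih cc S \<omega> t) = 1 \<and> real t \<le> B}"
    (is "?p \<le> measure M ?success")
proof -
  interpret bernoulli_arms M "arms K Ks" \<mu> Y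
    using model bandit
    by (auto simp: bernoulli_arms_def bernoulli_arms_axioms_def mlucb_model_def bandit_instance_def)
  \<comment> \<open>Three quarters of the normalised radius at rate \<open>L\<close>, a lower bound
    of \<open>\<beta>\<close>. The joint deviation then has exponent
    \<open>4 * \<epsilon>\<^sup>2 = 9 / 8 * L\<close>.\<close>
  define \<epsilon> where "\<epsilon> = 3 / 4 * sqrt (L / 2)"
  define G where "G = good_event x c \<epsilon> (1, 1) (2, 1) (2 * m)"
  have "0 \<le> b * ln L"
    using \<open>8 \<le> L\<close> \<open>0 \<le> b\<close> by simp
  then have "L \<le> x" "8 \<le> x"
    using \<open>8 \<le> L\<close> by (simp_all add: x_def)
  have rate: "\<beta> n = x + c * ln (ln (exp 1 * real n))" for n
    by (simp add: \<beta> explor_rate_eq x_def L_def)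
  have lnln: "0 \<le> ln (ln (exp 1 * real n))" "ln (ln (exp 1 * real n)) \<le> ln (ln (exp 1 * real t))"
    if "1 \<le> n" "n \<le> t" for n t :: nat
  proof -
    have "1 \<le> ln (exp 1 * real n)" "ln (exp 1 * real n) \<le> ln (exp 1 * real t)"
      using that by (simp_all add: ln_mult)
    then show "0 \<le> ln (ln (exp 1 * real n))" "ln (ln (exp 1 * real n)) \<le> ln (ln (exp 1 * real t))"
      by simp_all
  qed
  have \<epsilon>: "sqrt (real n) * \<epsilon> = 3 / 4 * sqrt (real n * L / 2)" for n :: nat
    by (simp add: \<epsilon>_def real_sqrt_mult real_sqrt_divide)
  have L_rate: "L \<le> \<beta> n" if "1 \<le> n" for n
    using lnln(1)[OF that order_refl] \<open>L \<le> x\<close> \<open>0 \<le> c\<close> by (simp add: rate add_increasing2)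
  have "G \<subseteq> ?success"
  proof
    fix \<omega> assume "\<omega> \<in> G"
    then have \<omega>: "\<omega> \<in> space M"
      and conc: "\<And>P n. P \<in> arms K Ks \<Longrightarrow> n \<in> {1..2 * m} \<Longrightarrow>
        \<bar>deviation (\<lambda>P n. Y P n \<omega>) \<mu> P n\<bar> < sqrt (real n * \<beta> n / 2)"
      and typical: "(\<forall>n\<in>{1..2 * m}. - deviation (\<lambda>P n. Y P n \<omega>) \<mu> (1, 1) n < 3 / 4 * sqrt (real n * L / 2)) \<or>
        (\<forall>n\<in>{1..2 * m}. deviation (\<lambda>P n. Y P n \<omega>) \<mu> (2, 1) n < 3 / 4 * sqrt (real n * L / 2))"
      unfolding G_def good_event_def \<epsilon> rate by blast+
    interpret run: mlucb K Ks \<mu> \<beta> m0 "ih (\<xi> \<omega>)" "cc (\<xi> \<omega>)" "S (\<xi> \<omega>)" "\<lambda>P n. Y P n \<omega>"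
      by (rule mlucb_run[OF \<omega>])
    interpret run: mlucb_concentrated K Ks \<mu> \<beta> m0 "ih (\<xi> \<omega>)" "cc (\<xi> \<omega>)" "S (\<xi> \<omega>)" "\<lambda>P n. Y P n \<omega>" "2 * m"
    proof
      show "0 \<le> \<beta> n" if "1 \<le> n" for n
        using L_rate[OF that] \<open>8 \<le> L\<close> by simp
      show "\<beta> n \<le> \<beta> t" if "1 \<le> n" "n \<le> t" for n t
        using lnln(2)[OF that] \<open>0 \<le> c\<close> by (simp add: rate mult_left_mono)
    qed (use conc in \<open>auto intro: less_imp_le\<close>)
    have "\<exists>k<m. mlucb_stops K Ks \<beta> m0 (run.hist (2 * k))"
      by (rule run.stops_early[where l = L]) (use typical L_rate m in \<open>auto intro: less_imp_le\<close>)
    then obtain k where k: "k < m" "mlucb_stops K Ks \<beta> m0 (run.hist (2 * k))"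
      by blast
    obtain t where "mlucb_time K Ks \<beta> m0 run.hist = enat t" "ih (\<xi> \<omega>) (run.hist t) = 1" "t \<le> 2 * (m - 1)"
      using run.mlucb_time_bound[OF k(1) order_refl k(2)] by blast
    moreover have "real t \<le> B"
      using \<open>t \<le> 2 * (m - 1)\<close> m(3) by linarith
    ultimately show "\<omega> \<in> ?success"
      using \<omega> by (auto simp: mlucb_history_def)
  qed
  then have "prob G \<le> prob ?success"
    by (intro finite_measure_mono sets_success)
  moreover have "?p \<le> prob G"
  proof -
    have "4 * \<epsilon>\<^sup>2 = 9 / 8 * L"
      using \<open>8 \<le> L\<close> by (simp add: \<epsilon>_def power_mult_distrib power2_eq_square)
    moreover have "(1, 1) \<noteq> (2 :: nat, 1 :: nat)" "0 \<le> \<epsilon>"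
      using \<open>8 \<le> L\<close> by (simp_all add: \<epsilon>_def)
    ultimately show ?thesis
      using good_event_prob[OF finite_arms first_arms _ \<open>8 \<le> x\<close> \<open>0 \<le> c\<close> _ s, of \<epsilon> "2 * m"]
      unfolding G_def by metis
  qed
  ultimately show ?thesis
    by linarith
qed

end

theorem corollary3:
  fixes c :: real
  assumes "c > 2"
  shows "\<exists>C>0. \<forall>b>c / 2. \<forall>K Ks \<mu>.
    bandit_instance K Ks \<mu> \<and> ordered_labels K Ks \<mu> \<and> \<mu> (1, 1) > \<mu> (2, 1) \<longrightarrow>
    (\<forall>\<^sub>F \<delta> in at_right 0.
      \<forall>m0 (M :: 'w measure) Y (R :: 'r measure) \<xi> ih cc S.
        mlucb_model K Ks \<mu> (explor_rate b c \<delta>) m0 M Y R \<xi> ih cc S \<longrightarrow>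
        measure M {\<omega> \<in> space M. \<exists>t.
            mlucb_time K Ks (explor_rate b c \<delta>) m0 (mlucb_history Y \<xi> ih cc S \<omega>) = enat t \<and>
            ih (\<xi> \<omega>) (mlucb_history Y \<xi> ih cc S \<omega> t) = 1 \<and>
            real t \<le> time_bound C (H_star K Ks \<mu>) \<delta>}
          > 1 - f_bc K Ks b c \<delta> * \<delta>)"
\<comment> \<open>The witness \<open>C = 1\<close> serves every \<open>c\<close>: the run stops by
  time \<open>4 * H * L\<close>, to which the other terms of the time bound only add.\<close>
proof (intro exI[of _ 1] conjI allI impI)
  fix b :: real and K :: nat and Ks :: "nat \<Rightarrow> nat" and \<mu> :: "arm \<Rightarrow> real"
  assume "c / 2 < b"
    and game: "bandit_instance K Ks \<mu> \<and> ordered_labels K Ks \<mu> \<and> \<mu> (2, 1) < \<mu> (1, 1)"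
  then interpret maximin_game K Ks \<mu>
    by unfold_locales auto
  have bc: "0 < b" "0 < c"
    using \<open>c / 2 < b\<close> assms by auto
  define H where "H = H_star K Ks \<mu>"
  define k where "k = real (card (arms K Ks))"
  have H: "4 \<le> H"
    unfolding H_def by (rule H_star_ge)
  have "1 \<le> k"
  proof -
    have "0 < card (arms K Ks)"
      using first_arms(1) finite_arms by (auto simp: card_gt_0_iff)
    then show ?thesis
      by (simp add: k_def)
  qed
  \<comment> \<open>The exponent lies strictly between 2 and \<open>c\<close>, which leaves room for
    the factor \<open>1 - 1 / (2 * x)\<close> once \<open>x\<close> is large.\<close>
  obtain s where s: "s < pi\<^sup>2 / 6"
    "\<And>J :: nat set. finite J \<Longrightarrow> 0 \<notin> J \<Longrightarrow> (\<Sum>k\<in>J. real k powr - ((c + 2) / 2)) \<le> s"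
    by (rule sum_powr_lt_zeta_2[of "(c + 2) / 2"]) (use assms in auto)
  \<comment> \<open>The slack between \<open>pi\<^sup>2 / 3\<close> in \<open>f_bc\<close> and
    \<open>2 * s\<close> in the tail bound, with common factors.\<close>
  define \<kappa> where "\<kappa> = k * sqrt (exp 1) * (pi\<^sup>2 / 3 - 2 * s)"
  have "0 < \<kappa>"
    unfolding \<kappa>_def using s(1) \<open>1 \<le> k\<close> by (intro mult_pos_pos) auto
  \<comment> \<open>The lower order terms of the draw count must fit into the one \<open>L\<close>
    that is freed by having \<open>2 * H - 1\<close> instead of \<open>2 * H\<close>. Here
    \<open>4 * H * L + 2\<close> stands for an upper bound of \<open>2 * m\<close>.\<close>
  have "((\<lambda>L. ((2 * H - 1) * (b * ln L + c * ln (ln (exp 1 * (4 * H * L + 2)))) + k) / L) \<longlongrightarrow> 0) at_top"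
    using bc H by real_asymp
  then have "\<forall>\<^sub>F L in at_top.
      ((2 * H - 1) * (b * ln L + c * ln (ln (exp 1 * (4 * H * L + 2)))) + k) / L < 1"
    by (rule order_tendstoD) simp
  \<comment> \<open>The joint deviation term against the slack, both divided by
    \<open>exp (- L)\<close>: the surplus \<open>L / 8\<close> in the exponent beats every power of
    \<open>L\<close>.\<close>
  moreover have "\<forall>\<^sub>F L in at_top. (4 * H * L + 2)\<^sup>2 * exp (- L / 8) < \<kappa> * L powr - b"
    using bc H \<open>0 < \<kappa>\<close> by real_asymp
  \<comment> \<open>The peeling requires 8. The other bound is \<open>c \<le> L * (c - 2)\<close>,
    which makes \<open>c * (1 - 1 / (2 * x))\<close> at least \<open>(c + 2) / 2\<close> for
    \<open>x \<ge> L\<close>.\<close>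
  moreover have "\<forall>\<^sub>F L in at_top. max 8 (c / (c - 2)) \<le> L"
    by (rule eventually_ge_at_top)
  ultimately have large: "\<forall>\<^sub>F L in at_top.
      ((2 * H - 1) * (b * ln L + c * ln (ln (exp 1 * (4 * H * L + 2)))) + k) / L < 1 \<and>
      (4 * H * L + 2)\<^sup>2 * exp (- L / 8) < \<kappa> * L powr - b \<and> max 8 (c / (c - 2)) \<le> L"
    by (intro eventually_conj)
  have "filterlim (\<lambda>\<delta>. ln (1 / \<delta>)) at_top (at_right (0 :: real))"
    by real_asymp
  with large have "\<forall>\<^sub>F \<delta> in at_right 0.
      ((2 * H - 1) * (b * ln (ln (1 / \<delta>)) + c * ln (ln (exp 1 * (4 * H * ln (1 / \<delta>) + 2)))) + k) / ln (1 / \<delta>) < 1 \<and>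
      (4 * H * ln (1 / \<delta>) + 2)\<^sup>2 * exp (- ln (1 / \<delta>) / 8) < \<kappa> * ln (1 / \<delta>) powr - b \<and>
      max 8 (c / (c - 2)) \<le> ln (1 / \<delta>)"
    by (rule eventually_compose_filterlim)
  with eventually_at_right_less have "\<forall>\<^sub>F \<delta> in at_right 0. 0 < \<delta> \<and>
      ((2 * H - 1) * (b * ln (ln (1 / \<delta>)) + c * ln (ln (exp 1 * (4 * H * ln (1 / \<delta>) + 2)))) + k) / ln (1 / \<delta>) < 1 \<and>
      (4 * H * ln (1 / \<delta>) + 2)\<^sup>2 * exp (- ln (1 / \<delta>) / 8) < \<kappa> * ln (1 / \<delta>) powr - b \<and>
      max 8 (c / (c - 2)) \<le> ln (1 / \<delta>)"
    by (rule eventually_conj)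
  then show "\<forall>\<^sub>F \<delta> in at_right 0.
      \<forall>m0 (M :: 'w measure) Y (R :: 'r measure) \<xi> ih cc S.
        mlucb_model K Ks \<mu> (explor_rate b c \<delta>) m0 M Y R \<xi> ih cc S \<longrightarrow>
        measure M {\<omega> \<in> space M. \<exists>t.
            mlucb_time K Ks (explor_rate b c \<delta>) m0 (mlucb_history Y \<xi> ih cc S \<omega>) = enat t \<and>
            ih (\<xi> \<omega>) (mlucb_history Y \<xi> ih cc S \<omega> t) = 1 \<and>
            real t \<le> time_bound 1 (H_star K Ks \<mu>) \<delta>}
          > 1 - f_bc K Ks b c \<delta> * \<delta>"
  proof (rule eventually_mono, intro allI impI)
    fix \<delta> :: real and m0 and M :: "'w measure" and Y and R :: "'r measure" and \<xi> ih cc S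
    assume model: "mlucb_model K Ks \<mu> (explor_rate b c \<delta>) m0 M Y R \<xi> ih cc S"
    define L where "L = ln (1 / \<delta>)"
    define x where "x = L + b * ln L"
    \<comment> \<open>The least integer above \<open>2 * H * L\<close>, so that
      \<open>2 * (m - 1) \<le> 4 * H * L\<close>.\<close>
    define m where "m = nat \<lfloor>2 * H * L\<rfloor> + 1"
    assume "0 < \<delta> \<and>
      ((2 * H - 1) * (b * ln (ln (1 / \<delta>)) + c * ln (ln (exp 1 * (4 * H * ln (1 / \<delta>) + 2)))) + k) / ln (1 / \<delta>) < 1 \<and>
      (4 * H * ln (1 / \<delta>) + 2)\<^sup>2 * exp (- ln (1 / \<delta>) / 8) < \<kappa> * ln (1 / \<delta>) powr - b \<and>
      max 8 (c / (c - 2)) \<le> ln (1 / \<delta>)"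
    then have "0 < \<delta>" and L: "8 \<le> L" "c / (c - 2) \<le> L"
      and small: "((2 * H - 1) * (b * ln L + c * ln (ln (exp 1 * (4 * H * L + 2)))) + k) / L < 1"
      and joint: "(4 * H * L + 2)\<^sup>2 * exp (- L / 8) < \<kappa> * L powr - b"
      by (simp_all add: L_def)
    interpret mlucb_sampling K Ks \<mu> "explor_rate b c \<delta>" m0 M Y R \<xi> ih cc S
      by unfold_locales (rule model)
    have "0 \<le> b * ln L"
      using L bc by simp
    then have x: "L \<le> x" "8 \<le> x"
      using L by (simp_all add: x_def)
    have HL: "0 \<le> 2 * H * L"
      using H L by simp
    then have m: "2 * H * L < real m" "real (m - 1) \<le> 2 * H * L"
      by (simp_all add: m_def) linarith+
    then have "real (2 * m) \<le> 4 * H * L + 2" "0 < m"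
      by (simp_all add: m_def)
    have zeta: "(\<Sum>k\<in>J. real k powr - (c * (1 - 1 / (2 * x)))) \<le> s" if "finite J" "0 \<notin> J" for J :: "nat set"
    proof -
      have "c \<le> L * (c - 2)"
        using L(2) assms by (simp add: pos_divide_le_eq)
      also have "\<dots> \<le> x * (c - 2)"
        using x assms by (intro mult_right_mono) auto
      finally have "c \<le> x * (c - 2)" .
      then have "(c + 2) / 2 \<le> c * (1 - 1 / (2 * x))"
        using x by (simp add: field_simps)
      then have "real k powr - (c * (1 - 1 / (2 * x))) \<le> real k powr - ((c + 2) / 2)" if "k \<in> J" for k
        using that \<open>0 \<notin> J\<close> by (intro powr_mono) (auto simp: Suc_le_eq intro: gr0I)
      then have "(\<Sum>k\<in>J. real k powr - (c * (1 - 1 / (2 * x)))) \<le> (\<Sum>k\<in>J. real k powr - ((c + 2) / 2))"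
        by (rule sum_mono)
      also have "\<dots> \<le> s"
        by (rule s(2)[OF that])
      finally show ?thesis .
    qed
    have "(2 * H_star K Ks \<mu> - 1) * explor_rate b c \<delta> (2 * m) + real (card (arms K Ks)) < real m"
    proof -
      have "ln (ln (exp 1 * real (2 * m))) \<le> ln (ln (exp 1 * (4 * H * L + 2)))"
      proof -
        have "1 \<le> ln (exp 1 * real (2 * m))"
          using \<open>0 < m\<close> by (simp add: ln_mult)
        moreover have "ln (exp 1 * real (2 * m)) \<le> ln (exp 1 * (4 * H * L + 2))"
          using \<open>0 < m\<close> \<open>real (2 * m) \<le> 4 * H * L + 2\<close> by simp
        ultimately show ?thesis
          by simp
      qed
      then have "explor_rate b c \<delta> (2 * m) \<le> L + (b * ln L + c * ln (ln (exp 1 * (4 * H * L + 2))))"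
        using bc by (simp add: explor_rate_eq flip: L_def)
      then have "(2 * H - 1) * explor_rate b c \<delta> (2 * m) + k \<le>
          (2 * H - 1) * (L + (b * ln L + c * ln (ln (exp 1 * (4 * H * L + 2))))) + k"
        using H by (intro add_right_mono mult_left_mono) auto
      also have "\<dots> = (2 * H - 1) * L + ((2 * H - 1) * (b * ln L + c * ln (ln (exp 1 * (4 * H * L + 2)))) + k)"
        by (simp add: distrib_left)
      also have "\<dots> < (2 * H - 1) * L + L"
        using small L by (simp add: pos_divide_less_eq)
      also have "\<dots> = 2 * H * L"
        by (simp add: algebra_simps)
      also note m(1)
      finally show ?thesis
        by (simp add: H_def k_def)
    qed
    moreover have "real (2 * (m - 1)) \<le> time_bound 1 H \<delta>"
    proof -
      \<comment> \<open>Both correction terms of the time bound are nonnegative, since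
        \<open>8 * H \<ge> 1\<close> and
        \<open>ln (8 * H / \<delta>) \<ge> L \<ge> 8\<close>.\<close>
      have "0 \<le> ln (8 * H)"
        using H by simp
      moreover have "ln (8 * H / \<delta>) = ln (8 * H) + L"
        using H \<open>0 < \<delta>\<close> by (simp add: L_def ln_div ln_mult)
      ultimately have "L \<le> L + ln (8 * H) + 2 * ln (ln (8 * H / \<delta>))"
        using L by simp
      then have "4 * H * L \<le> 4 * H * (L + ln (8 * H) + 2 * ln (ln (8 * H / \<delta>)))"
        using H by (intro mult_left_mono) auto
      with m(2) show ?thesis
        by (simp add: time_bound_def L_def)
    qed
    ultimately have prob: "1 - (k * (2 * (sqrt (exp 1) * s * (sqrt x / (2 * sqrt 2) + 1) powr c * exp (- x))) +
        (real (2 * m))\<^sup>2 * exp (- (9 / 8 * L)))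
      \<le> measure M {\<omega> \<in> space M. \<exists>t.
          mlucb_time K Ks (explor_rate b c \<delta>) m0 (mlucb_history Y \<xi> ih cc S \<omega>) = enat t \<and>
          ih (\<xi> \<omega>) (mlucb_history Y \<xi> ih cc S \<omega> t) = 1 \<and> real t \<le> time_bound 1 (H_star K Ks \<mu>) \<delta>}"
      unfolding k_def x_def L_def H_def using success_probability[OF refl \<open>0 < \<delta>\<close>, of s m]
        zeta L bc \<open>0 < m\<close> by (auto simp: x_def L_def)
    \<comment> \<open>The factor common to the tail bound and \<open>f_bc\<close>. It is at least
      \<open>exp (- x)\<close>, which is how the joint term comes below
      \<open>\<kappa> * q\<close>.\<close>
    define q where "q = (sqrt x / (2 * sqrt 2) + 1) powr c * exp (- x)"
    have "(real (2 * m))\<^sup>2 * exp (- (9 / 8 * L)) < \<kappa> * q"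
    proof -
      have "(real (2 * m))\<^sup>2 * exp (- (9 / 8 * L)) \<le> (4 * H * L + 2)\<^sup>2 * exp (- (9 / 8 * L))"
        using \<open>real (2 * m) \<le> 4 * H * L + 2\<close> by (intro mult_right_mono power_mono) auto
      also have "\<dots> = (4 * H * L + 2)\<^sup>2 * exp (- L / 8) * exp (- L)"
        by (simp add: mult.assoc flip: exp_add)
      also have "\<dots> < \<kappa> * L powr - b * exp (- L)"
        using joint by simp
      also have "\<dots> = \<kappa> * exp (- x)"
        using L by (simp add: x_def powr_def flip: exp_add)
      also have "\<dots> \<le> \<kappa> * q"
      proof -
        have "1 \<le> (sqrt x / (2 * sqrt 2) + 1) powr c"
          using x bc by (intro ge_one_powr_ge_zero) auto
        then show ?thesis
          using \<open>0 < \<kappa>\<close> by (simp add: q_def)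
      qed
      finally show ?thesis .
    qed
    moreover have "f_bc K Ks b c \<delta> * \<delta> = k * (sqrt (exp 1) * (pi\<^sup>2 / 3) * q)"
      using f_bc_mult_eq[of \<delta> b K Ks c] \<open>0 < \<delta>\<close> L bc by (simp add: k_def q_def x_def L_def)
    \<comment> \<open>The tail bound falls short of \<open>f_bc\<close> times
      \<open>\<delta>\<close> by exactly \<open>\<kappa> * q\<close>. The joint term is strictly
      smaller than this, hence the strict inequality.\<close>
    moreover have "k * (2 * (sqrt (exp 1) * s * (sqrt x / (2 * sqrt 2) + 1) powr c * exp (- x))) =
        k * (sqrt (exp 1) * (pi\<^sup>2 / 3) * q) - \<kappa> * q"
      by (simp add: \<kappa>_def q_def algebra_simps)
    ultimately show "measure M {\<omega> \<in> space M. \<exists>t.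
            mlucb_time K Ks (explor_rate b c \<delta>) m0 (mlucb_history Y \<xi> ih cc S \<omega>) = enat t \<and>
            ih (\<xi> \<omega>) (mlucb_history Y \<xi> ih cc S \<omega> t) = 1 \<and>
            real t \<le> time_bound 1 (H_star K Ks \<mu>) \<delta>}
          > 1 - f_bc K Ks b c \<delta> * \<delta>"
      using prob by linarith
  qed
qed simp

end
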